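(* Let $\beta$ be a nonreal number, and let $\{\mu_k\}_{k=1}^{n-1}$, with $\mu_1<\dots<\mu_{n-1}$, and $\{\lambda_j\}_{j=1}^n$ be sets of distinct real numbers with no common elements. Put $\chi_n(\lambda)=\prod_{j=1}^n(\lambda-\lambda_j)$. Then there exists a matrix $\widehat{J}_n$ in the class $\widehat{\mathcal{J}}_n$ with $\widehat{a}_n\in\mathbb{R}$ and $\widehat{b}_1\widehat b_2\cdots\widehat{b}_n=\beta$ such that the spectrum of $\widehat{J}_n$ is $\{\lambda_1,\dots,\lambda_n\}$ and the spectrum of its leading principal $(n-1)\times(n-1)$ submatrix $\widehat{J}_{n-1}$ is $\{\mu_1,\dots,\mu_{n-1}\}$, if and only if $$(-1)^{n-k}\chi_n(\mu_k)>0\quad\text{and}\quad|\chi_n(\mu_k)+2\operatorname{Re}\beta|\ge2|\beta|,\qquad k=1,\dots,n-1.$$ Moreover, if there are $m$ $(0\le m\le n-1)$ equalities in these conditions (that is, among the inequalities $|\chi_n(\mu_k)+2\operatorname{Re}\beta|\ge2|\beta|$), then there exist exactly $2^{n-m-1}$ matrices in the class $\widehat{\mathcal{J}}_n$ with these spectral data (the spectrum $\{\lambda_j\}$ of the matrix, the spectrum $\{\mu_k\}$ of its leading principal $(n-1)\times(n-1)$ submatrix, and the number $\beta=\widehat b_1\cdots\widehat b_n$).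
   Context: $\widehat{\mathcal{J}}_n$ is the class of complex $n\times n$ matrices $$\widehat{J}_n=\begin{pmatrix} \widehat{c}_1 & \widehat{b}_1 & 0 &\dots& 0 & \overline{\widehat{b}}_n\\ \widehat{b}_1 & \widehat{c}_2 & \widehat{b}_2 &\dots& 0 & 0\\ 0 & \widehat{b}_2 & \widehat{c}_3 &\dots& 0 & 0\\ \vdots&\vdots&\vdots&\ddots&\vdots&\vdots\\ 0&0&0&\dots&\widehat{c}_{n-1}&\widehat{b}_{n-1}\\ \widehat{b}_n&0&0&\dots&\widehat{b}_{n-1}&\widehat{a}_n \end{pmatrix},$$ i.e. the diagonal entries are $\widehat c_1,\dots,\widehat c_{n-1},\widehat a_n$; the $(k,k+1)$ and $(k+1,k)$ entries are $\widehat b_k$ for $k=1,\dots,n-1$; the $(1,n)$ entry is $\overline{\widehat b}_n$ and the $(n,1)$ entry is $\widehat b_n$; all other entries are $0$. Here $\widehat{c}_1,\dots,\widehat{c}_{n-1},\widehat{b}_1,\dots,\widehat{b}_{n-1}\in\mathbb{R}$, and $\widehat{a}_n,\widehat{b}_n\in\mathbb{C}$ with $\widehat{b}_n\ne0$.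
   Formalization: Since flipping signs of the real b_k gives further matrices with the same data, the count 2^(n-m-1) is proved for matrices up to conjugation by ±1 diagonal matrices, and for those with b_1,…,b_{n-1} > 0; n ≥ 3 is assumed, as the displayed matrix requires. *)

theory Defs
  imports Complex_Main "Jordan_Normal_Form.Spectral_Radius" "Jordan_Normal_Form.DL_Submatrix"
begin

text \<open>
  Parameters carry the indices of the display: \<open>c k\<close> and \<open>b k\<close> are used for
  \<open>1 \<le> k \<le> n - 1\<close> only, and \<open>a\<close>, \<open>bn\<close> stand for \<open>a\<^sub>n\<close>, \<open>b\<^sub>n\<close>.
  Matrices of Jordan_Normal_Form are indexed from 0, hence the shift.
  The pattern is only meaningful for \<open>n \<ge> 3\<close>: for smaller \<open>n\<close> the corner positions
  collide with the tridiagonal part.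
\<close>

definition hat_J :: "nat \<Rightarrow> (nat \<Rightarrow> real) \<Rightarrow> (nat \<Rightarrow> real) \<Rightarrow> complex \<Rightarrow> complex \<Rightarrow> complex mat" where
  "hat_J n c b a bn = mat n n (\<lambda>(i, j).
     let k = i + 1; l = j + 1 in
     if k = l then (if k = n then a else complex_of_real (c k))
     else if l = k + 1 then complex_of_real (b k)
     else if k = l + 1 then complex_of_real (b l)
     else if k = 1 \<and> l = n then cnj bn
     else if k = n \<and> l = 1 then bn
     else 0)"

definition chi :: "nat \<Rightarrow> (nat \<Rightarrow> real) \<Rightarrow> real \<Rightarrow> real" where
  "chi n lam x = (\<Prod>j = 1..n. x - lam j)"

definition leading_submatrix :: "nat \<Rightarrow> complex mat \<Rightarrow> complex mat" where
  "leading_submatrix k A = submatrix A {..<k} {..<k}"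

definition solutions ::
    "nat \<Rightarrow> (nat \<Rightarrow> real) \<Rightarrow> (nat \<Rightarrow> real) \<Rightarrow> complex \<Rightarrow> complex mat set" where
  "solutions n lam mu \<beta> =
    {J. (\<exists>c b a bn. J = hat_J n c b a bn \<and> bn \<noteq> 0 \<and>
           (\<Prod>k = 1..n - 1. complex_of_real (b k)) * bn = \<beta>) \<and>
        spectrum J = complex_of_real ` lam ` {1..n} \<and>
        spectrum (leading_submatrix (n - 1) J) = complex_of_real ` mu ` {1..n - 1}}"

text \<open>
  Conjugation by a diagonal matrix \<open>D = diag(\<epsilon>\<^sub>0, \<dots>, \<epsilon>\<^sub>n\<^sub>-\<^sub>1)\<close> with entries \<open>\<plusminus>1\<close>.
  It flips signs of the \<open>b\<^sub>k\<close> and preserves the matrix class, both spectra and the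
  product \<open>b\<^sub>1 \<cdots> b\<^sub>n\<close>. As the signs of the real numbers \<open>b\<^sub>k\<close> are not prescribed,
  every solution with \<open>\<beta> \<noteq> 0\<close> therefore comes with \<open>2\<^sup>n\<^sup>-\<^sup>1\<close> sign variants, and
  solutions can only be counted modulo this relation.
\<close>

definition sign_similar :: "nat \<Rightarrow> (complex mat \<times> complex mat) set" where
  "sign_similar n =
    {(A, B). \<exists>\<epsilon> :: nat \<Rightarrow> complex. (\<forall>i < n. \<epsilon> i \<in> {1, -1}) \<and>
       B = mat n n (\<lambda>(i, j). \<epsilon> i * A $$ (i, j) * \<epsilon> j)}"

text \<open>
  The solutions in which all of \<open>b\<^sub>1, \<dots>, b\<^sub>n\<^sub>-\<^sub>1\<close> are positive; the entry with
  0-based index \<open>(k - 1, k)\<close> is \<open>b\<^sub>k\<close>, a real number.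
\<close>

definition positive_solutions ::
    "nat \<Rightarrow> (nat \<Rightarrow> real) \<Rightarrow> (nat \<Rightarrow> real) \<Rightarrow> complex \<Rightarrow> complex mat set" where
  "positive_solutions n lam mu \<beta> =
    {J \<in> solutions n lam mu \<beta>. \<forall>k \<in> {1..n - 1}. Re (J $$ (k - 1, k)) > 0}"

end

theory Submission
  imports Defs "HOL-Library.FuncSet"
begin

text \<open>
  Put \<open>N = n - 1\<close> and let \<open>P\<^sub>k\<close> be the characteristic polynomial of the leading \<open>k \<times> k\<close> Jacobi submatrix. Expanding
  the determinant of the full matrix along its corners gives
  \<open>\<chi>\<^sub>n(x) = (x - a) P\<^sub>N(x) - \<bar>b\<^sub>n\<bar>\<^sup>2 S\<^sub>N(x) - b\<^sub>N\<^sup>2 P\<^sub>N\<^sub>-\<^sub>1(x) - 2 Re \<beta>\<close>,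
  where \<open>S\<^sub>N\<close> belongs to the section without first and last row and column (\<open>spectrum_hat_J\<close>, proved by solving the
  eigenvector equations). At \<open>x = \<mu>\<^sub>k\<close>, a root of \<open>P\<^sub>N\<close>, put \<open>t\<^sub>k = - b\<^sub>N\<^sup>2 P\<^sub>N\<^sub>-\<^sub>1(\<mu>\<^sub>k)\<close>. The identity
  \<open>S\<^sub>N P\<^sub>N\<^sub>-\<^sub>1 - P\<^sub>N S\<^sub>N\<^sub>-\<^sub>1 = (b\<^sub>1 \<cdots> b\<^sub>N\<^sub>-\<^sub>1)\<^sup>2\<close> (\<open>casoratian\<close>) shows that the product of \<open>t\<^sub>k\<close> and
  \<open>- \<bar>b\<^sub>n\<bar>\<^sup>2 S\<^sub>N(\<mu>\<^sub>k)\<close> is \<open>\<bar>\<beta>\<bar>\<^sup>2\<close>, so that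
  \<open>t\<^sub>k + \<bar>\<beta>\<bar>\<^sup>2 / t\<^sub>k = \<chi>\<^sub>n(\<mu>\<^sub>k) + 2 Re \<beta>\<close>,
  and interlacing (\<open>wronskian_pos\<close>) shows that \<open>u\<^sub>k = (-1)\<^sup>n\<^sup>-\<^sup>k t\<^sub>k\<close>, called the weight below, is positive. A positive \<open>u\<^sub>k\<close>
  with this property exists if and only if \<open>(-1)\<^sup>n\<^sup>-\<^sup>k (\<chi>\<^sub>n(\<mu>\<^sub>k) + 2 Re \<beta>) \<ge> 2 \<bar>\<beta>\<bar>\<close>, which for nonreal \<open>\<beta>\<close> is
  equivalent to the two conditions of the theorem. There are two such \<open>u\<^sub>k\<close> if the inequality is strict and one in
  the case of equality.

  Conversely every choice of admissible weights comes from exactly one matrix with positive \<open>b\<^sub>1, \<dots>, b\<^sub>N\<close>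
  (\<open>positive_solution_exists\<close>, \<open>positive_solution_unique\<close>): the weights are the values of \<open>b\<^sub>N\<^sup>2 P\<^sub>N\<^sub>-\<^sub>1\<close> at the \<open>\<mu>\<^sub>k\<close>
  up to sign, and \<open>P\<^sub>N\<close> and \<open>P\<^sub>N\<^sub>-\<^sub>1\<close> determine the Jacobi matrix by the Euclidean algorithm (\<open>jacobi_exists\<close>,
  \<open>jacobi_coefficients_unique\<close>). Hence the number of positive solutions is the product of the numbers of admissible
  weights, \<open>2\<^sup>N\<^sup>-\<^sup>m\<close>. Finally every class of sign-similar solutions contains exactly one positive solution
  (\<open>card_solution_classes\<close>).
\<close>

text \<open>Below, \<open>smult\<close> is the multiplication of a polynomial by a scalar.\<close>

hide_const (open) Module.smult

section \<open>Three-term recurrences\<close>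

text \<open>
  The characteristic polynomial of the \<open>k \<times> k\<close> Jacobi matrix with diagonal \<open>c\<^sub>1, \<dots>, c\<^sub>k\<close> and off-diagonal
  entries whose squares are \<open>d\<^sub>1, \<dots>, d\<^sub>k\<^sub>-\<^sub>1\<close>. Working with the squares removes the choice of signs.
\<close>

fun jacobi_poly :: "(nat \<Rightarrow> 'a) \<Rightarrow> (nat \<Rightarrow> 'a) \<Rightarrow> nat \<Rightarrow> 'a :: field poly" where
  "jacobi_poly c d 0 = 1"
| "jacobi_poly c d (Suc 0) = [:- c 1, 1:]"
| "jacobi_poly c d (Suc (Suc k)) =
     [:- c (k + 2), 1:] * jacobi_poly c d (Suc k) - smult (d (Suc k)) (jacobi_poly c d k)"

text \<open>
  The solution of the recurrence of \<open>jacobi_poly\<close> with initial values \<open>0, 1\<close>. For \<open>k \<ge> 1\<close> it is the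
  characteristic polynomial of the Jacobi matrix with entries \<open>c\<^sub>2, \<dots>, c\<^sub>k\<close> and \<open>d\<^sub>2, \<dots>, d\<^sub>k\<^sub>-\<^sub>1\<close>, that is,
  of the section that omits the first row and column.
\<close>

fun assoc_poly :: "(nat \<Rightarrow> 'a) \<Rightarrow> (nat \<Rightarrow> 'a) \<Rightarrow> nat \<Rightarrow> 'a :: field poly" where
  "assoc_poly c d 0 = 0"
| "assoc_poly c d (Suc 0) = 1"
| "assoc_poly c d (Suc (Suc k)) =
     [:- c (k + 2), 1:] * assoc_poly c d (Suc k) - smult (d (Suc k)) (assoc_poly c d k)"

text \<open>
  With \<open>d\<^sub>j = b\<^sub>j\<^sup>2\<close>, \<open>g = \<bar>b\<^sub>n\<bar>\<^sup>2\<close> and \<open>s = 2 Re (b\<^sub>1 \<cdots> b\<^sub>n)\<close> this is the characteristic polynomial of the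
  matrix of size \<open>n = N + 1\<close>: expanding along the corner entries, the two cyclic permutations contribute
  \<open>b\<^sub>1 \<cdots> b\<^sub>n\<close> and its conjugate, the two diagonal cofactors contribute the other two terms.
\<close>

definition periodic_poly ::
    "(nat \<Rightarrow> 'a) \<Rightarrow> (nat \<Rightarrow> 'a) \<Rightarrow> 'a \<Rightarrow> 'a \<Rightarrow> 'a \<Rightarrow> nat \<Rightarrow> 'a :: field poly" where
  "periodic_poly c d a g s N = [:- a, 1:] * jacobi_poly c d N - smult g (assoc_poly c d N)
     - smult (d N) (jacobi_poly c d (N - 1)) - [:s:]"

text \<open>
  The recurrence of \<open>jacobi_poly\<close>, the definition of \<open>periodic_poly\<close> and the multiplication by a further linear
  factor all have this shape, so this one fact gives degrees and leading coefficients throughout.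
\<close>

lemma monic_linear_mult_diff:
  fixes p q :: "'a :: field poly"
  assumes "degree p = k" "lead_coeff p = 1" "degree q \<le> k"
  shows "degree ([:- a, 1:] * p - q) = Suc k \<and> lead_coeff ([:- a, 1:] * p - q) = 1"
proof -
  have p: "p \<noteq> 0" using assms by auto
  have d: "degree ([:- a, 1:] * p) = Suc k"
    using assms p by (subst degree_mult_eq) auto
  have l: "coeff ([:- a, 1:] * p) (Suc k) = 1"
    using d assms lead_coeff_mult[of "[:- a, 1:]" p] by simp
  have c: "coeff ([:- a, 1:] * p - q) (Suc k) = 1"
    using l assms by (simp add: coeff_eq_0)
  moreover have "degree ([:- a, 1:] * p - q) \<le> Suc k"
    using d assms by (intro degree_diff_le) auto
  ultimately have "degree ([:- a, 1:] * p - q) = Suc k"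
    by (metis le_antisym le_degree zero_neq_one)
  with c show ?thesis by simp
qed

lemma jacobi_poly_monic: "degree (jacobi_poly c d k) = k" "lead_coeff (jacobi_poly c d k) = 1"
proof -
  have "degree (jacobi_poly c d k) = k \<and> lead_coeff (jacobi_poly c d k) = 1"
  proof (induction c d k rule: jacobi_poly.induct)
    case (3 c d k)
    show ?case unfolding jacobi_poly.simps
      by (rule monic_linear_mult_diff) (use 3 in \<open>auto intro: order_trans[OF degree_smult_le]\<close>)
  qed auto
  thus "degree (jacobi_poly c d k) = k" "lead_coeff (jacobi_poly c d k) = 1" by auto
qed

lemma degree_assoc_poly: "degree (assoc_poly c d k) \<le> k - 1"
proof (induction c d k rule: assoc_poly.induct)
  case (3 c d k)
  show ?case unfolding assoc_poly.simps
  proof (rule degree_diff_le)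
    show "degree ([:- c (k + 2), 1:] * assoc_poly c d (Suc k)) \<le> Suc (Suc k) - 1"
      using 3 degree_mult_le[of "[:- c (k + 2), 1:]" "assoc_poly c d (Suc k)"] by simp
    show "degree (smult (d (Suc k)) (assoc_poly c d k)) \<le> Suc (Suc k) - 1"
      using 3 degree_smult_le[of "d (Suc k)" "assoc_poly c d k"] by linarith
  qed
qed auto

lemma periodic_poly_monic:
  assumes "N \<ge> 1"
  shows "degree (periodic_poly c d a g s N) = Suc N" "lead_coeff (periodic_poly c d a g s N) = 1"
proof -
  let ?q = "smult g (assoc_poly c d N) + smult (d N) (jacobi_poly c d (N - 1)) + [:s:]"
  have q: "degree ?q \<le> N"
    using degree_assoc_poly[of c d N] jacobi_poly_monic(1)[of c d "N - 1"]
    by (intro degree_add_le order_trans[OF degree_smult_le]) auto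
  have "periodic_poly c d a g s N = [:- a, 1:] * jacobi_poly c d N - ?q"
    unfolding periodic_poly_def by (simp add: algebra_simps)
  with monic_linear_mult_diff[OF jacobi_poly_monic[of c d N] q, of a]
  show "degree (periodic_poly c d a g s N) = Suc N" "lead_coeff (periodic_poly c d a g s N) = 1"
    by metis+
qed

lemma jacobi_poly_cong:
  assumes "\<And>i. i \<in> {1..k} \<Longrightarrow> c i = c' i" "\<And>i. i \<in> {1..<k} \<Longrightarrow> d i = d' i"
  shows "jacobi_poly c d k = jacobi_poly c' d' k"
  using assms
proof (induction k rule: less_induct)
  case (less k)
  consider "k = 0" | "k = 1" | j where "k = Suc (Suc j)" by (metis One_nat_def not0_implies_Suc)
  thus ?case
  proof cases
    case 3
    have "jacobi_poly c d (Suc j) = jacobi_poly c' d' (Suc j)" "jacobi_poly c d j = jacobi_poly c' d' j"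
      using 3 less.prems by (auto intro!: less.IH)
    with 3 less.prems show ?thesis by auto
  qed (use less.prems in auto)
qed

lemma assoc_poly_cong:
  assumes "\<And>i. i \<in> {1..k} \<Longrightarrow> c i = c' i" "\<And>i. i \<in> {1..<k} \<Longrightarrow> d i = d' i"
  shows "assoc_poly c d k = assoc_poly c' d' k"
  using assms
proof (induction k rule: less_induct)
  case (less k)
  consider "k = 0" | "k = 1" | j where "k = Suc (Suc j)" by (metis One_nat_def not0_implies_Suc)
  thus ?case
  proof cases
    case 3
    have "assoc_poly c d (Suc j) = assoc_poly c' d' (Suc j)" "assoc_poly c d j = assoc_poly c' d' j"
      using 3 less.prems by (auto intro!: less.IH)
    with 3 less.prems show ?thesis by auto
  qed (use less.prems in auto)
qed

lemma poly_of_real_jacobi: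
  "poly (jacobi_poly (\<lambda>i. of_real (c i)) (\<lambda>i. of_real (d i)) k) (of_real x) =
     (of_real (poly (jacobi_poly c d k) x) :: 'a :: {real_field})"
  by (induction c d k rule: jacobi_poly.induct) simp_all

lemma poly_of_real_assoc:
  "poly (assoc_poly (\<lambda>i. of_real (c i)) (\<lambda>i. of_real (d i)) k) (of_real x) =
     (of_real (poly (assoc_poly c d k) x) :: 'a :: {real_field})"
  by (induction c d k rule: assoc_poly.induct) simp_all

text \<open>
  Both sequences solve the same second order recurrence, so their Casorati determinant is multiplied by
  \<open>d\<^sub>k\<close> in each step. It is what turns the corner contribution \<open>\<bar>b\<^sub>n\<bar>\<^sup>2\<close> times \<open>assoc_poly\<close> at a root of
  \<open>jacobi_poly\<close> into the reciprocal of the contribution of \<open>b\<^sub>n\<^sub>-\<^sub>1\<^sup>2\<close>.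
\<close>

lemma casoratian:
  "assoc_poly c d (Suc k) * jacobi_poly c d k - jacobi_poly c d (Suc k) * assoc_poly c d k
     = [:\<Prod>j = 1..k. d j:]"
proof (induction k)
  case (Suc k)
  have "assoc_poly c d (Suc (Suc k)) * jacobi_poly c d (Suc k)
          - jacobi_poly c d (Suc (Suc k)) * assoc_poly c d (Suc k)
        = smult (d (Suc k)) (assoc_poly c d (Suc k) * jacobi_poly c d k
            - jacobi_poly c d (Suc k) * assoc_poly c d k)"
    by (simp add: algebra_simps smult_diff_right)
  also have "\<dots> = [:\<Prod>j = 1..Suc k. d j:]"
    unfolding Suc.IH by (simp add: prod.nat_ivl_Suc' mult.commute)
  finally show ?case .
qed simp

text \<open>
  The Wronskian satisfies \<open>W\<^sub>k\<^sub>+\<^sub>1 = P\<^sub>k\<^sub>+\<^sub>1\<^sup>2 + d\<^sub>k\<^sub>+\<^sub>1 W\<^sub>k\<close> and starts at \<open>1\<close>. At a root of the larger polynomial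
  only one product survives, so the smaller polynomial has there the sign of the derivative of the larger
  one: this is the interlacing of the two spectra in the form in which it is used below.
\<close>

lemma wronskian_pos:
  fixes c d :: "nat \<Rightarrow> real"
  assumes "\<And>j. j \<in> {1..k} \<Longrightarrow> d j > 0"
  shows "poly (pderiv (jacobi_poly c d (Suc k))) x * poly (jacobi_poly c d k) x
       - poly (jacobi_poly c d (Suc k)) x * poly (pderiv (jacobi_poly c d k)) x > 0"
  using assms
proof (induction k)
  case 0
  then show ?case by (simp add: pderiv_pCons)
next
  case (Suc k)
  let ?P = "\<lambda>k. poly (jacobi_poly c d k) x" and ?P' = "\<lambda>k. poly (pderiv (jacobi_poly c d k)) x"
  have IH: "?P' (Suc k) * ?P k - ?P (Suc k) * ?P' k > 0" using Suc by auto
  have "?P' (Suc (Suc k)) * ?P (Suc k) - ?P (Suc (Suc k)) * ?P' (Suc k)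
      = (?P (Suc k))\<^sup>2 + d (Suc k) * (?P' (Suc k) * ?P k - ?P (Suc k) * ?P' k)"
    by (simp add: pderiv_diff pderiv_add pderiv_smult pderiv_mult pderiv_pCons algebra_simps power2_eq_square)
  also have "\<dots> > 0" using IH Suc.prems[of "Suc k"] by (intro add_nonneg_pos mult_pos_pos) auto
  finally show ?case .
qed

text \<open>
  Two consecutive polynomials determine the whole recurrence: comparing leading coefficients yields the
  last \<open>c\<close> and the last \<open>d\<close>, hence the preceding polynomial, and so on down.
\<close>

lemma jacobi_coefficients_unique:
  assumes "jacobi_poly c d (Suc N) = jacobi_poly c' d' (Suc N)"
    and "jacobi_poly c d N = jacobi_poly c' d' N"
    and "\<And>j. j \<in> {1..N} \<Longrightarrow> d j \<noteq> 0" "\<And>j. j \<in> {1..N} \<Longrightarrow> d' j \<noteq> 0"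
  shows "(\<forall>j\<in>{1..Suc N}. c j = c' j) \<and> (\<forall>j\<in>{1..N}. d j = d' j)"
  using assms
proof (induction N)
  case 0
  then show ?case by simp
next
  case (Suc N)
  let ?P = "jacobi_poly c d" and ?P' = "jacobi_poly c' d'"
  have m: "degree (?P k) = k" "coeff (?P k) k = 1" "degree (?P' k) = k" "coeff (?P' k) k = 1" for k
    using jacobi_poly_monic[of c d k] jacobi_poly_monic[of c' d' k] by auto
  have e: "smult (c' (Suc (Suc N)) - c (Suc (Suc N))) (?P (Suc N))
      = smult (d (Suc N)) (?P N) - smult (d' (Suc N)) (?P' N)"
    using Suc.prems(1,2) by (simp add: algebra_simps smult_diff_left)
  have "coeff (smult (c' (Suc (Suc N)) - c (Suc (Suc N))) (?P (Suc N))) (Suc N) = 0"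
    unfolding e by (simp add: coeff_eq_0 m)
  hence c: "c (Suc (Suc N)) = c' (Suc (Suc N))" using m by simp
  hence e': "smult (d (Suc N)) (?P N) = smult (d' (Suc N)) (?P' N)" using e by simp
  hence "coeff (smult (d (Suc N)) (?P N)) N = coeff (smult (d' (Suc N)) (?P' N)) N" by simp
  hence d: "d (Suc N) = d' (Suc N)" using m by simp
  have "smult (inverse (d (Suc N))) (smult (d (Suc N)) (?P N))
      = smult (inverse (d (Suc N))) (smult (d (Suc N)) (?P' N))"
    using e' d by simp
  hence "?P N = ?P' N" using Suc.prems(3)[of "Suc N"] by simp
  hence "(\<forall>j\<in>{1..Suc N}. c j = c' j) \<and> (\<forall>j\<in>{1..N}. d j = d' j)"
    using Suc by auto
  with c d show ?case by (auto simp: le_Suc_eq)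
qed

section \<open>The inverse problem for Jacobi matrices\<close>

lemma prod_linear_monic:
  fixes mu :: "'b \<Rightarrow> 'a :: field"
  assumes "finite S"
  shows "degree (\<Prod>j\<in>S. [:- mu j, 1:]) = card S" "lead_coeff (\<Prod>j\<in>S. [:- mu j, 1:]) = 1"
proof -
  have "degree (\<Prod>j\<in>S. [:- mu j, 1:]) = card S \<and> lead_coeff (\<Prod>j\<in>S. [:- mu j, 1:]) = 1"
    using assms
  proof (induction S rule: finite_induct)
    case (insert a S)
    let ?p = "\<Prod>j\<in>S. [:- mu j, 1:]"
    have "degree ([:- mu a, 1:] * ?p - 0) = Suc (card S) \<and> lead_coeff ([:- mu a, 1:] * ?p - 0) = 1"
      using insert.IH by (intro monic_linear_mult_diff) auto
    thus ?case
      unfolding diff_0_right prod.insert[OF insert.hyps] card_insert_disjoint[OF insert.hyps] .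
  qed simp
  thus "degree (\<Prod>j\<in>S. [:- mu j, 1:]) = card S" "lead_coeff (\<Prod>j\<in>S. [:- mu j, 1:]) = 1" by auto
qed

lemma monic_eq_prod_linear:
  fixes p :: "'a :: field poly"
  assumes "finite S" "inj_on mu S" "degree p = card S" "lead_coeff p = 1"
    and "\<And>k. k \<in> S \<Longrightarrow> poly p (mu k) = 0"
  shows "p = (\<Prod>j\<in>S. [:- mu j, 1:])"
proof (rule poly_eqI_degree_lead_coeff[where n = "card S" and A = "mu ` S"])
  show "poly p z = poly (\<Prod>j\<in>S. [:- mu j, 1:]) z" if "z \<in> mu ` S" for z
  proof -
    from that obtain k where k: "k \<in> S" "z = mu k" by auto
    hence "(\<Prod>j\<in>S. mu k - mu j) = 0" using assms(1) by (intro prod_zero) auto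
    with k assms(5) show ?thesis by (simp add: poly_prod)
  qed
qed (use assms prod_linear_monic[OF assms(1), of mu] in \<open>auto simp: card_image\<close>)

lemma sign_prod_diff:
  fixes mu :: "'b \<Rightarrow> real"
  assumes "finite S" "x \<notin> mu ` S"
  shows "(-1) ^ card {j \<in> S. x < mu j} * (\<Prod>j\<in>S. x - mu j) > 0"
  using assms
proof (induction S rule: finite_induct)
  case (insert a S)
  show ?case
  proof (cases "x < mu a")
    case True
    hence "{j \<in> insert a S. x < mu j} = insert a {j \<in> S. x < mu j}" by auto
    hence "(-1) ^ card {j \<in> insert a S. x < mu j} * (\<Prod>j\<in>insert a S. x - mu j)
        = (mu a - x) * ((-1) ^ card {j \<in> S. x < mu j} * (\<Prod>j\<in>S. x - mu j))"
      using insert.hyps by (simp add: algebra_simps)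
    also have "\<dots> > 0" using insert True by (intro mult_pos_pos[of "mu a - x"]) auto
    finally show ?thesis .
  next
    case False
    hence "{j \<in> insert a S. x < mu j} = {j \<in> S. x < mu j}" by auto
    hence "(-1) ^ card {j \<in> insert a S. x < mu j} * (\<Prod>j\<in>insert a S. x - mu j)
        = (x - mu a) * ((-1) ^ card {j \<in> S. x < mu j} * (\<Prod>j\<in>S. x - mu j))"
      using insert.hyps by (simp add: algebra_simps)
    also have "\<dots> > 0" using insert False by (intro mult_pos_pos[of "x - mu a"]) auto
    finally show ?thesis .
  qed
qed simp

text \<open>
  The product is the derivative at \<open>\<mu>\<^sub>k\<close> of the polynomial with roots \<open>\<mu>\<^sub>1 < \<dots> < \<mu>\<^sub>N\<close>; exactly the \<open>N - k\<close>
  roots above \<open>\<mu>\<^sub>k\<close> contribute a negative factor.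
\<close>

lemma sign_derivative_at_node:
  fixes mu :: "nat \<Rightarrow> real"
  assumes "strict_mono_on {1..N} mu" "k \<in> {1..N}"
  shows "(-1) ^ (N - k) * (\<Prod>j\<in>{1..N} - {k}. mu k - mu j) > 0"
proof -
  have less: "mu i < mu j \<longleftrightarrow> i < j" if "i \<in> {1..N}" "j \<in> {1..N}" for i j
    using strict_mono_on_less[OF assms(1)] that by blast
  have "{j \<in> {1..N} - {k}. mu k < mu j} = {k<..N}"
    using assms less by (auto)
  hence "card {j \<in> {1..N} - {k}. mu k < mu j} = N - k" by simp
  moreover have "mu k \<notin> mu ` ({1..N} - {k})"
    using inj_onD[OF strict_mono_on_imp_inj_on[OF assms(1)], of k] assms(2) by auto
  ultimately show ?thesis
    using sign_prod_diff[of "{1..N} - {k}" "mu k" mu] by simp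
qed

lemma lagrange_interpolation:
  fixes mu v :: "'b \<Rightarrow> 'a :: field"
  assumes "finite S" "inj_on mu S" "card S = Suc N"
  obtains f where "degree f \<le> N" "\<And>k. k \<in> S \<Longrightarrow> poly f (mu k) = v k"
    "coeff f N = (\<Sum>k\<in>S. v k / (\<Prod>j\<in>S - {k}. mu k - mu j))"
proof
  define w where "w k = v k / (\<Prod>j\<in>S - {k}. mu k - mu j)" for k
  define l where "l k = (\<Prod>j\<in>S - {k}. [:- mu j, 1:])" for k
  have l: "degree (l k) = N" "coeff (l k) N = 1" if "k \<in> S" for k
    using prod_linear_monic[of "S - {k}" mu] that assms unfolding l_def by auto
  show "degree (\<Sum>k\<in>S. smult (w k) (l k)) \<le> N"
    using assms l by (intro degree_sum_le) (auto intro: order_trans[OF degree_smult_le])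
  show "coeff (\<Sum>k\<in>S. smult (w k) (l k)) N = (\<Sum>k\<in>S. v k / (\<Prod>j\<in>S - {k}. mu k - mu j))"
    unfolding coeff_sum by (intro sum.cong) (auto simp: l w_def)
  fix k assume k: "k \<in> S"
  have "poly (\<Sum>k\<in>S. smult (w k) (l k)) (mu k) = (\<Sum>i\<in>S. w i * poly (l i) (mu k))"
    by (simp add: poly_sum)
  also have "\<dots> = (\<Sum>i\<in>{k}. w i * poly (l i) (mu k))"
  proof (rule sum.mono_neutral_right)
    show "\<forall>i\<in>S - {k}. w i * poly (l i) (mu k) = 0"
    proof
      fix i assume "i \<in> S - {k}"
      hence "(\<Prod>j\<in>S - {i}. mu k - mu j) = 0" using k assms by (intro prod_zero) auto
      thus "w i * poly (l i) (mu k) = 0" by (simp add: l_def poly_prod)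
    qed
  qed (use k assms in auto)
  also have "\<dots> = v k"
  proof -
    have "mu k - mu j \<noteq> 0" if "j \<in> S - {k}" for j
      using that k assms(2) by (auto dest: inj_onD)
    hence "(\<Prod>j\<in>S - {k}. mu k - mu j) \<noteq> 0" using assms by simp
    thus ?thesis by (simp add: w_def l_def poly_prod)
  qed
  finally show "poly (\<Sum>k\<in>S. smult (w k) (l k)) (mu k) = v k" .
qed

text \<open>
  By Lagrange interpolation the coefficient is the sum of \<open>r(\<mu>\<^sub>k) / p'(\<mu>\<^sub>k)\<close>, where \<open>p\<close> is the polynomial with the
  nodes as roots. Values and derivatives alternate in the same way, so every summand is positive.
\<close>

lemma alternating_lead_coeff_pos:
  fixes r :: "real poly"
  assumes "strict_mono_on {1..Suc N} mu" "degree r \<le> N"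
    and "\<And>k. k \<in> {1..Suc N} \<Longrightarrow> (-1) ^ (Suc N - k) * poly r (mu k) > 0"
  shows "coeff r N > 0"
proof -
  have inj: "inj_on mu {1..Suc N}" using assms(1) by (rule strict_mono_on_imp_inj_on)
  obtain f where f: "degree f \<le> N" "\<And>k. k \<in> {1..Suc N} \<Longrightarrow> poly f (mu k) = poly r (mu k)"
    "coeff f N = (\<Sum>k\<in>{1..Suc N}. poly r (mu k) / (\<Prod>j\<in>{1..Suc N} - {k}. mu k - mu j))"
    using lagrange_interpolation[OF _ inj, of N "\<lambda>k. poly r (mu k)"] by auto
  have card: "card (mu ` {1..Suc N}) = Suc N" using card_image[OF inj] by simp
  have "r = f"
    by (rule poly_eqI_degree[where A = "mu ` {1..Suc N}"]) (use f(1,2) assms(2) card in auto)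
  moreover have "0 < (\<Sum>k\<in>{1..Suc N}. poly r (mu k) / (\<Prod>j\<in>{1..Suc N} - {k}. mu k - mu j))"
  proof (rule sum_pos)
    fix k assume k: "k \<in> {1..Suc N}"
    have "0 < ((-1) ^ (Suc N - k) * poly r (mu k))
        / ((-1) ^ (Suc N - k) * (\<Prod>j\<in>{1..Suc N} - {k}. mu k - mu j))"
      using assms(3)[OF k] sign_derivative_at_node[OF assms(1) k] by (rule divide_pos_pos)
    thus "0 < poly r (mu k) / (\<Prod>j\<in>{1..Suc N} - {k}. mu k - mu j)" by simp
  qed auto
  ultimately show ?thesis using f(3) by simp
qed

text \<open>
  The inverse spectral problem for Jacobi matrices, solved by Sturm's division. By the intermediate value
  theorem \<open>q\<close> has a root \<open>\<nu>\<^sub>k\<close> in each gap of the \<open>\<mu>\<^sub>k\<close>. Dividing \<open>p = \<Prod>(x - \<mu>\<^sub>k)\<close> by \<open>q\<close> gives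
  \<open>p = (x - c) q - r\<close>, and \<open>r = - p\<close> at every \<open>\<nu>\<^sub>k\<close>, so that \<open>r\<close> alternates on the \<open>\<nu>\<^sub>k\<close>. Its leading coefficient is
  then positive and serves as the last \<open>d\<close>, and the normalised remainder with the nodes \<open>\<nu>\<^sub>k\<close> satisfies the
  hypotheses for the smaller size.
\<close>

lemma jacobi_exists:
  fixes q :: "real poly"
  assumes "strict_mono_on {1..Suc N} mu" "degree q = N" "lead_coeff q = 1"
    and "\<And>k. k \<in> {1..Suc N} \<Longrightarrow> (-1) ^ (Suc N - k) * poly q (mu k) > 0"
  obtains c d where "\<And>j. j \<in> {1..N} \<Longrightarrow> d j > 0"
    "jacobi_poly c d (Suc N) = (\<Prod>j=1..Suc N. [:- mu j, 1:])" "jacobi_poly c d N = q"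
proof -
  have "\<exists>c d. (\<forall>j\<in>{1..N}. d j > 0) \<and> jacobi_poly c d (Suc N) = (\<Prod>j=1..Suc N. [:- mu j, 1:])
      \<and> jacobi_poly c d N = q"
    using assms
  proof (induction N arbitrary: q mu)
    case 0
    have "q = 1" using 0 by (auto elim!: degree_eq_zeroE)
    thus ?case by (intro exI[of _ mu]) auto
  next
    case (Suc N)
    define p where "p = (\<Prod>j=1..Suc (Suc N). [:- mu j, 1:])"
    have p: "degree p = Suc (Suc N)" "coeff p (Suc (Suc N)) = 1"
      using prod_linear_monic[of "{1..Suc (Suc N)}" mu] unfolding p_def by auto
    have less: "mu i < mu j \<longleftrightarrow> i < j" if "i \<in> {1..Suc (Suc N)}" "j \<in> {1..Suc (Suc N)}" for i j
      using strict_mono_on_less[OF Suc.prems(1)] that by blast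
    have "\<exists>x. mu k < x \<and> x < mu (Suc k) \<and> poly q x = 0" if k: "k \<in> {1..Suc N}" for k
    proof -
      have "0 < ((-1) ^ (Suc (Suc N) - k) * poly q (mu k))
          * ((-1) ^ (Suc (Suc N) - Suc k) * poly q (mu (Suc k)))"
        using k by (intro mult_pos_pos[OF Suc.prems(4) Suc.prems(4)]) auto
      also have "\<dots> = - (poly q (mu k) * poly q (mu (Suc k)))"
      proof -
        have "Suc (Suc N) - k = Suc (Suc N - k)" using k by auto
        thus ?thesis by (simp add: algebra_simps flip: power_mult_distrib)
      qed
      finally have "poly q (mu k) * poly q (mu (Suc k)) < 0" by simp
      moreover have "mu k < mu (Suc k)" using less k by simp
      ultimately show ?thesis using poly_IVT by blast
    qed
    then obtain nu where nu:
      "\<And>k. k \<in> {1..Suc N} \<Longrightarrow> mu k < nu k \<and> nu k < mu (Suc k) \<and> poly q (nu k) = 0" by metis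
    have mono: "strict_mono_on {1..Suc N} nu"
    proof (rule strict_mono_onI)
      fix i j assume ij: "i \<in> {1..Suc N}" "j \<in> {1..Suc N}" "i < j"
      have "mu (Suc i) \<le> mu j"
        using ij less[of "Suc i" j] by (cases "Suc i = j") auto
      thus "nu i < nu j" using nu[OF ij(1)] nu[OF ij(2)] by linarith
    qed
    have inj: "inj_on nu {1..Suc N}" using mono by (rule strict_mono_on_imp_inj_on)
    have q: "q = (\<Prod>j=1..Suc N. [:- nu j, 1:])"
      using Suc.prems(2,3) nu by (intro monic_eq_prod_linear inj) auto
    have sign_p: "(-1) ^ (Suc (Suc N) - k) * poly p (nu k) > 0" if k: "k \<in> {1..Suc N}" for k
    proof -
      have lt: "nu k < mu j \<longleftrightarrow> k < j" and ne: "nu k \<noteq> mu j" if j: "j \<in> {1..Suc (Suc N)}" for j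
      proof -
        have low: "mu j < nu k" if "j \<le> k"
          using that less[of j k] j k nu[OF k] by (cases "j = k") auto
        have high: "nu k < mu j" if "k < j"
          using that less[of "Suc k" j] j k nu[OF k] by (cases "j = Suc k") auto
        show "nu k < mu j \<longleftrightarrow> k < j" using low high by (cases "j \<le> k") auto
        show "nu k \<noteq> mu j" using low high by (cases "j \<le> k") auto
      qed
      have "{j \<in> {1..Suc (Suc N)}. nu k < mu j} = {k<..Suc (Suc N)}" using lt by auto
      moreover have "nu k \<notin> mu ` {1..Suc (Suc N)}" using ne by blast
      ultimately show ?thesis
        using sign_prod_diff[of "{1..Suc (Suc N)}" "nu k" mu]
        by (simp add: p_def poly_prod del: prod.cl_ivl_Suc)
    qed
    \<comment> \<open>This \<open>c\<close> cancels the coefficient of degree \<open>N + 1\<close> of the remainder.\<close>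
    define c where "c = coeff (pCons 0 q - p) (Suc N)"
    define r where "r = [:- c, 1:] * q - p"
    have "coeff r i = 0" if "i > N" for i
    proof -
      consider "i = Suc N" | "i = Suc (Suc N)" | "i > Suc (Suc N)" using \<open>i > N\<close> by linarith
      thus ?thesis
        using Suc.prems(2,3) p by cases (auto simp: r_def c_def coeff_pCons coeff_eq_0 split: nat.splits)
    qed
    hence deg_r: "degree r \<le> N" by (intro degree_le) auto
    have sign_r: "(-1) ^ (Suc N - k) * poly r (nu k) > 0" if k: "k \<in> {1..Suc N}" for k
    proof -
      have "Suc (Suc N) - k = Suc (Suc N - k)" using k by auto
      thus ?thesis using sign_p[OF k] nu[OF k] by (simp add: r_def)
    qed
    define B where "B = coeff r N"
    have B: "B > 0" unfolding B_def by (rule alternating_lead_coeff_pos[OF mono deg_r sign_r])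
    define q' where "q' = smult (1 / B) r"
    have "degree r = N" using B deg_r le_degree[of r N] by (auto simp: B_def)
    hence q': "degree q' = N" "lead_coeff q' = 1"
      using B by (auto simp: q'_def B_def)
    have "(-1) ^ (Suc N - k) * poly q' (nu k) > 0" if k: "k \<in> {1..Suc N}" for k
      using sign_r[OF k] B by (simp add: q'_def zero_less_divide_iff)
    from Suc.IH[OF mono q' this] obtain c0 d0 where cd: "\<forall>j\<in>{1..N}. d0 j > 0"
      "jacobi_poly c0 d0 (Suc N) = q" "jacobi_poly c0 d0 N = q'" unfolding q by blast
    define c1 d1 where "c1 = c0(Suc (Suc N) := c)" and "d1 = d0(Suc N := B)"
    have "jacobi_poly c1 d1 (Suc N) = q" "jacobi_poly c1 d1 N = q'"
      unfolding cd(2,3)[symmetric] c1_def d1_def by (auto intro!: jacobi_poly_cong)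
    moreover have "jacobi_poly c1 d1 (Suc (Suc N)) = p"
      unfolding jacobi_poly.simps calculation using B
      by (simp add: c1_def d1_def q'_def) (simp add: r_def)
    moreover have "\<forall>j\<in>{1..Suc N}. d1 j > 0" using cd(1) B by (auto simp: d1_def)
    ultimately show ?case unfolding p_def by blast
  qed
  thus ?thesis using that by blast
qed

section \<open>The characteristic polynomials\<close>

text \<open>
  Since no \<open>b\<^sub>j\<close> vanishes, the equations determine \<open>y\<^sub>1, \<dots>, y\<^sub>N\<close> from \<open>y\<^sub>0\<close> and the forcing term \<open>g\<close>. In an
  eigenvector equation \<open>g\<close> is the contribution of the upper right corner to the first row.
\<close>

lemma three_term_solution:
  fixes b c y :: "nat \<Rightarrow> 'a :: field" and x g :: 'a
  assumes b: "\<And>j. j \<in> {1..N} \<Longrightarrow> b j \<noteq> 0"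
  defines "R \<equiv> \<lambda>k. poly (jacobi_poly c (\<lambda>j. (b j)\<^sup>2) k) x"
    and "S \<equiv> \<lambda>k. poly (assoc_poly c (\<lambda>j. (b j)\<^sup>2) k) x"
  shows "(\<forall>k<N. b (Suc k) * y (Suc k)
                = (x - c (Suc k)) * y k - (if k = 0 then g else b k * y (k - 1))) \<longleftrightarrow>
         (\<forall>k\<le>N. (\<Prod>j = 1..k. b j) * y k = R k * y 0 - S k * g)"
proof -
  have R: "R 0 = 1" "R 1 = x - c 1"
    "R (Suc (Suc k)) = (x - c (Suc (Suc k))) * R (Suc k) - (b (Suc k))\<^sup>2 * R k" for k
    by (simp_all add: R_def algebra_simps)
  have S: "S 0 = 0" "S 1 = 1"
    "S (Suc (Suc k)) = (x - c (Suc (Suc k))) * S (Suc k) - (b (Suc k))\<^sup>2 * S k" for k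
    by (simp_all add: S_def algebra_simps)
  let ?F = "\<lambda>k. (\<Prod>j = 1..k. b j) * y k = R k * y 0 - S k * g"
  let ?E = "\<lambda>k. b (Suc k) * y (Suc k)
                = (x - c (Suc k)) * y k - (if k = 0 then g else b k * y (k - 1))"
  have step: "?E (Suc k) \<longleftrightarrow> ?F (Suc (Suc k))" if "Suc k < N" "?F k" "?F (Suc k)" for k
  proof -
    define P where "P = (\<Prod>j = 1..k. b j)"
    have P: "(\<Prod>j = 1..Suc k. b j) = P * b (Suc k)"
      "(\<Prod>j = 1..Suc (Suc k). b j) = P * b (Suc k) * b (Suc (Suc k))"
      by (simp_all add: P_def)
    have nz: "P * b (Suc k) \<noteq> 0" using b that unfolding P_def by auto
    have 1: "P * y k = R k * y 0 - S k * g" using that(2) unfolding P_def .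
    have 2: "P * b (Suc k) * y (Suc k) = R (Suc k) * y 0 - S (Suc k) * g" using that(3) unfolding P .
    have "?E (Suc k) \<longleftrightarrow> P * b (Suc k) * (b (Suc (Suc k)) * y (Suc (Suc k)))
        = P * b (Suc k) * ((x - c (Suc (Suc k))) * y (Suc k) - b (Suc k) * y k)"
      using nz by simp
    also have "P * b (Suc k) * ((x - c (Suc (Suc k))) * y (Suc k) - b (Suc k) * y k)
        = (x - c (Suc (Suc k))) * (P * b (Suc k) * y (Suc k)) - (b (Suc k))\<^sup>2 * (P * y k)"
      by (simp add: algebra_simps power2_eq_square)
    also have "\<dots> = R (Suc (Suc k)) * y 0 - S (Suc (Suc k)) * g"
      unfolding 1 2 R S by (simp add: algebra_simps)
    finally show ?thesis unfolding P by (simp add: mult.assoc)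
  qed
  show ?thesis
  proof
    assume E: "\<forall>k<N. ?E k"
    have "k \<le> N \<longrightarrow> ?F k" for k
    proof (induction k rule: less_induct)
      case (less k)
      consider "k = 0" | "k = 1" | j where "k = Suc (Suc j)" by (metis One_nat_def not0_implies_Suc)
      thus ?case
      proof cases
        case 2
        thus ?thesis using E R S by auto
      next
        case 3
        thus ?thesis using less[of j] less[of "Suc j"] step[of j] E by simp
      qed (simp add: R S)
    qed
    thus "\<forall>k\<le>N. ?F k" by blast
  next
    assume F: "\<forall>k\<le>N. ?F k"
    show "\<forall>k<N. ?E k"
    proof (intro allI impI)
      fix k assume k: "k < N"
      show "?E k"
      proof (cases k)
        case 0
        thus ?thesis using F[rule_format, of 1] R S k by simp
      next
        case (Suc j)
        thus ?thesis using step[of j] k F[rule_format, of j] F[rule_format, of k] F[rule_format, of "Suc k"]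
          by simp
      qed
    qed
  qed
qed

lemma hat_J_mult_vec:
  fixes c b :: "nat \<Rightarrow> real" and a bn :: complex
  assumes N: "N \<ge> 2" and v: "v \<in> carrier_vec (Suc N)"
  defines "J \<equiv> hat_J (Suc N) c b a bn"
  shows "(J *\<^sub>v v) $ 0 = c 1 * v $ 0 + b 1 * v $ 1 + cnj bn * v $ N"
    and "k \<in> {1..<N} \<Longrightarrow>
      (J *\<^sub>v v) $ k = b k * v $ (k - 1) + c (Suc k) * v $ k + b (Suc k) * v $ Suc k"
    and "(J *\<^sub>v v) $ N = bn * v $ 0 + b N * v $ (N - 1) + a * v $ N"
proof -
  have sum: "(J *\<^sub>v v) $ i = (\<Sum>j\<in>A. J $$ (i, j) * v $ j)"
    if "i < Suc N" "A \<subseteq> {0..<Suc N}" "\<And>j. j \<in> {0..<Suc N} - A \<Longrightarrow> J $$ (i, j) = 0" for i A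
  proof -
    have "(J *\<^sub>v v) $ i = (\<Sum>j\<in>{0..<Suc N}. J $$ (i, j) * v $ j)"
      using v that(1) by (simp add: J_def hat_J_def scalar_prod_def)
    also have "\<dots> = (\<Sum>j\<in>A. J $$ (i, j) * v $ j)"
      using that by (intro sum.mono_neutral_right) auto
    finally show ?thesis .
  qed
  have entry: "J $$ (i, j) = (if i = j then (if i = N then a else of_real (c (Suc i)))
     else if j = Suc i then of_real (b (Suc i)) else if i = Suc j then of_real (b (Suc j))
     else if i = 0 \<and> j = N then cnj bn else if i = N \<and> j = 0 then bn else 0)"
    if "i < Suc N" "j < Suc N" for i j
    using that by (simp add: J_def hat_J_def Let_def)
  have "(J *\<^sub>v v) $ 0 = (\<Sum>j\<in>{0, 1, N}. J $$ (0, j) * v $ j)"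
    using N by (intro sum) (auto simp: entry)
  thus "(J *\<^sub>v v) $ 0 = c 1 * v $ 0 + b 1 * v $ 1 + cnj bn * v $ N"
    using N by (simp add: entry)
  have "(J *\<^sub>v v) $ N = (\<Sum>j\<in>{0, N - 1, N}. J $$ (N, j) * v $ j)"
    using N by (intro sum) (auto simp: entry)
  thus "(J *\<^sub>v v) $ N = bn * v $ 0 + b N * v $ (N - 1) + a * v $ N"
    using N by (auto simp: entry)
  assume k: "k \<in> {1..<N}"
  then obtain i where i: "k = Suc i" by (cases k) auto
  have "(J *\<^sub>v v) $ k = (\<Sum>j\<in>{k - 1, k, Suc k}. J $$ (k, j) * v $ j)"
    using N k by (intro sum) (auto simp: entry)
  thus "(J *\<^sub>v v) $ k = b k * v $ (k - 1) + c (Suc k) * v $ k + b (Suc k) * v $ Suc k"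
    using N k by (simp add: i entry)
qed

lemma hat_J_interior_rows:
  fixes c b :: "nat \<Rightarrow> real"
  assumes N: "N \<ge> 2" and v: "v \<in> carrier_vec (Suc N)" and b: "\<And>j. j \<in> {1..N} \<Longrightarrow> b j \<noteq> 0"
  shows "(\<forall>k<N. (hat_J (Suc N) c b a bn *\<^sub>v v) $ k = x * v $ k) \<longleftrightarrow>
    (\<forall>k\<le>N. (\<Prod>j = 1..k. complex_of_real (b j)) * v $ k =
       poly (jacobi_poly (\<lambda>j. of_real (c j)) (\<lambda>j. of_real ((b j)\<^sup>2)) k) x * v $ 0
       - poly (assoc_poly (\<lambda>j. of_real (c j)) (\<lambda>j. of_real ((b j)\<^sup>2)) k) x * (cnj bn * v $ N))"
proof -
  have "(\<forall>k<N. (hat_J (Suc N) c b a bn *\<^sub>v v) $ k = x * v $ k) \<longleftrightarrow>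
     (\<forall>k<N. of_real (b (Suc k)) * v $ (Suc k) = (x - of_real (c (Suc k))) * v $ k
        - (if k = 0 then cnj bn * v $ N else of_real (b k) * v $ (k - 1)))"
  proof (intro all_cong)
    fix k assume k: "k < N"
    show "(hat_J (Suc N) c b a bn *\<^sub>v v) $ k = x * v $ k \<longleftrightarrow>
      of_real (b (Suc k)) * v $ (Suc k) = (x - of_real (c (Suc k))) * v $ k
        - (if k = 0 then cnj bn * v $ N else of_real (b k) * v $ (k - 1))"
    proof (cases "k = 0")
      case True
      show ?thesis unfolding True hat_J_mult_vec(1)[OF N v] by (auto simp: algebra_simps)
    next
      case False
      hence "k \<in> {1..<N}" using k by auto
      thus ?thesis using False unfolding hat_J_mult_vec(2)[OF N v \<open>k \<in> {1..<N}\<close>]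
        by (auto simp: algebra_simps)
    qed
  qed
  moreover have "complex_of_real (b j) \<noteq> 0" if "j \<in> {1..N}" for j using b that by simp
  note three_term_solution[OF this, where c = "\<lambda>j. complex_of_real (c j)" and y = "\<lambda>k. v $ k"
      and x = x and g = "cnj bn * v $ N"]
  ultimately show ?thesis unfolding of_real_power by (rule trans)
qed

text \<open>
  By \<open>hat_J_interior_rows\<close> the first \<open>N\<close> rows express every component of an eigenvector through its first
  and last component. What is left are two homogeneous linear equations in these two unknowns: consistency
  of the last component, and the last row. Their determinant is, up to a nonzero factor, the value of
  \<open>periodic_poly\<close>; the mixed terms combine by \<open>casoratian\<close>.
\<close>

lemma spectrum_hat_J:
  fixes c b :: "nat \<Rightarrow> real"
  assumes N: "N \<ge> 2" and b: "\<And>j. j \<in> {1..N} \<Longrightarrow> b j \<noteq> 0"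
  shows "spectrum (hat_J (Suc N) c b a bn) =
    {x. poly (periodic_poly (\<lambda>j. of_real (c j)) (\<lambda>j. of_real ((b j)\<^sup>2)) a (of_real ((cmod bn)\<^sup>2))
        (of_real (2 * Re ((\<Prod>k = 1..N. of_real (b k)) * bn))) N) x = 0}"
proof -
  define J where "J = hat_J (Suc N) c b a bn"
  have dim: "dim_row J = Suc N" "dim_col J = Suc N" by (simp_all add: J_def hat_J_def)
  define B where "B k = (\<Prod>j = 1..k. complex_of_real (b j))" for k
  obtain M where M: "N = Suc M" using N by (cases N) auto
  have B: "B k \<noteq> 0" if "k \<le> N" for k using that b by (auto simp: B_def)
  have BN: "B N = B M * b N" by (simp add: B_def M)
  define C D where "C = (\<lambda>j. complex_of_real (c j))" and "D = (\<lambda>j. complex_of_real ((b j)\<^sup>2))"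
  have "poly (periodic_poly C D a (of_real ((cmod bn)\<^sup>2)) (of_real (2 * Re (B N * bn))) N) x = 0
      \<longleftrightarrow> eigenvalue J x" for x
  proof -
    define R S where "R k = poly (jacobi_poly C D k) x" and "S k = poly (assoc_poly C D k) x" for k
    have RS: "R 0 = 1" "S 0 = 0" by (simp_all add: R_def S_def)
    have interior: "(\<forall>k<N. (J *\<^sub>v v) $ k = x * v $ k) \<longleftrightarrow>
      (\<forall>k\<le>N. B k * v $ k = R k * v $ 0 - S k * (cnj bn * v $ N))" if "v \<in> carrier_vec (Suc N)" for v
      using hat_J_interior_rows[OF N that b] unfolding J_def B_def R_def S_def C_def D_def .
    \<comment> \<open>The two equations are \<open>p v\<^sub>0 + q v\<^sub>N = 0\<close> and \<open>r v\<^sub>0 + s v\<^sub>N = 0\<close>.\<close>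
    define p q r s where "p = R N" and "q = - (S N * cnj bn + B N)"
      and "r = bn * B M + b N * R M" and "s = - ((x - a) * B M + b N * S M * cnj bn)"
    have cas: "S N * R M - R N * S M = (B M)\<^sup>2"
      using arg_cong[OF casoratian[of C D M], of "\<lambda>p. poly p x"]
      by (simp add: R_def S_def M B_def D_def prod_power_distrib)
    have det: "p * s - q * r = - (B M)
        * poly (periodic_poly C D a (of_real ((cmod bn)\<^sup>2)) (of_real (2 * Re (B N * bn))) N) x"
    proof -
      have rb: "cnj (B N) = B N" by (simp add: B_def)
      have g: "complex_of_real ((cmod bn)\<^sup>2) = bn * cnj bn" by (rule complex_norm_square)
      have s: "complex_of_real (2 * Re (B N * bn)) = B N * (bn + cnj bn)"
        by (subst complex_add_cnj[symmetric]) (simp add: rb algebra_simps)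
      have P: "poly (periodic_poly C D a (of_real ((cmod bn)\<^sup>2)) (of_real (2 * Re (B N * bn))) N) x
        = (x - a) * R N - bn * cnj bn * S N - (of_real (b N))\<^sup>2 * R M - B N * (bn + cnj bn)"
        unfolding periodic_poly_def g s by (simp add: R_def S_def M D_def left_diff_distrib)
      have "p * s - q * r = - (B M) * ((x - a) * R N - bn * cnj bn * S N
            - (of_real (b N))\<^sup>2 * R M - B N * (bn + cnj bn))
          + of_real (b N) * cnj bn * ((S N * R M - R N * S M) - (B M)\<^sup>2)"
        unfolding p_def q_def r_def s_def BN by (simp add: algebra_simps power2_eq_square)
      thus ?thesis unfolding P cas by simp
    qed
    have lin: "(J *\<^sub>v v) $ N = x * v $ N \<longleftrightarrow> r * v $ 0 + s * v $ N = 0"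
      if v: "v \<in> carrier_vec (Suc N)"
        and FM: "B M * v $ M = R M * v $ 0 - S M * (cnj bn * v $ N)" for v
    proof -
      have "(J *\<^sub>v v) $ N = x * v $ N \<longleftrightarrow> bn * v $ 0 + b N * v $ M + a * v $ N = x * v $ N"
        using hat_J_mult_vec(3)[OF N v, of c b a bn] by (simp add: J_def M)
      also have "\<dots> \<longleftrightarrow> B M * (bn * v $ 0 + b N * v $ M + a * v $ N) = B M * (x * v $ N)"
        using B[of M] M by simp
      also have "\<dots> \<longleftrightarrow> bn * B M * v $ 0 + b N * (B M * v $ M) + a * B M * v $ N = x * B M * v $ N"
        by (simp add: algebra_simps)
      also have "\<dots> \<longleftrightarrow> r * v $ 0 + s * v $ N = 0"
        unfolding FM r_def s_def by (simp add: algebra_simps) 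
      finally show ?thesis .
    qed
    show ?thesis
    proof
      assume "eigenvalue J x"
      then obtain v where v: "v \<in> carrier_vec (Suc N)" "v \<noteq> 0\<^sub>v (Suc N)" "J *\<^sub>v v = x \<cdot>\<^sub>v v"
        by (auto simp: eigenvalue_def eigenvector_def dim)
      have Jv: "(J *\<^sub>v v) $ k = x * v $ k" if "k \<le> N" for k using v that by simp
      have F: "\<forall>k\<le>N. B k * v $ k = R k * v $ 0 - S k * (cnj bn * v $ N)"
        using interior[OF v(1)] Jv by auto
      have 1: "p * v $ 0 + q * v $ N = 0"
        using F[rule_format, of N] by (simp add: p_def q_def algebra_simps)
      have 2: "r * v $ 0 + s * v $ N = 0"
        using lin[OF v(1) F[rule_format, of M]] Jv M by auto
      have "v $ 0 \<noteq> 0 \<or> v $ N \<noteq> 0"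
      proof (rule ccontr)
        assume "\<not> (v $ 0 \<noteq> 0 \<or> v $ N \<noteq> 0)"
        hence "v $ k = 0" if "k \<le> N" for k using F[rule_format, of k] B[of k] that by simp
        hence "v = 0\<^sub>v (Suc N)" using v(1) by (intro eq_vecI) auto
        with v(2) show False ..
      qed
      moreover have "(p * s - q * r) * v $ 0
          = s * (p * v $ 0 + q * v $ N) - q * (r * v $ 0 + s * v $ N)"
        "(p * s - q * r) * v $ N
          = p * (r * v $ 0 + s * v $ N) - r * (p * v $ 0 + q * v $ N)"
        by (simp_all add: algebra_simps)
      ultimately have "p * s - q * r = 0" unfolding 1 2 by auto
      thus "poly (periodic_poly C D a (of_real ((cmod bn)\<^sup>2)) (of_real (2 * Re (B N * bn))) N) x = 0"
        unfolding det using B[of M] M by simp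
    next
      assume "poly (periodic_poly C D a (of_real ((cmod bn)\<^sup>2)) (of_real (2 * Re (B N * bn))) N) x = 0"
      hence det0: "p * s = q * r" using det by simp
      obtain u w where uw: "u \<noteq> 0 \<or> w \<noteq> 0" "p * u + q * w = 0" "r * u + s * w = 0"
      proof (cases "p = 0 \<and> q = 0")
        case True
        show ?thesis
        proof (cases "r = 0 \<and> s = 0")
          case True
          with \<open>p = 0 \<and> q = 0\<close> show ?thesis using that[of 1 1] by simp
        next
          case False
          thus ?thesis using that[of s "- r"] \<open>p = 0 \<and> q = 0\<close> by auto
        qed
      next
        case False
        thus ?thesis using that[of q "- p"] det0 by (auto simp: algebra_simps)
      qed
      define v where "v = vec (Suc N) (\<lambda>k. (R k * u - S k * (cnj bn * w)) / B k)"
      have v: "v \<in> carrier_vec (Suc N)" by (simp add: v_def)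
      have v0: "v $ 0 = u" by (simp add: v_def RS B_def)
      have "R N * u - S N * (cnj bn * w) = B N * w"
        using uw(2) unfolding p_def q_def by (simp add: algebra_simps eq_neg_iff_add_eq_0)
      hence vN: "v $ N = w" using B[of N] by (simp add: v_def)
      have F: "\<forall>k\<le>N. B k * v $ k = R k * v $ 0 - S k * (cnj bn * v $ N)"
        unfolding v0 vN using B by (simp add: v_def)
      have "(J *\<^sub>v v) $ k = x * v $ k" if "k \<le> N" for k
      proof (cases "k = N")
        case True
        have "(J *\<^sub>v v) $ N = x * v $ N" using lin[OF v F[rule_format, of M]] M uw(3) v0 vN by auto
        with True show ?thesis by simp
      next
        case False
        thus ?thesis using interior[OF v] F that by auto
      qed
      hence "J *\<^sub>v v = x \<cdot>\<^sub>v v" using v dim by (intro eq_vecI) (auto simp del: index_mult_mat_vec)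
      moreover have "v \<noteq> 0\<^sub>v (Suc N)" using uw(1) v0 vN by auto
      ultimately show "eigenvalue J x"
        using v by (auto simp: eigenvalue_def eigenvector_def dim)
    qed
  qed
  thus ?thesis unfolding spectrum_def J_def B_def C_def D_def by blast
qed

lemma leading_submatrix_eq:
  assumes "A \<in> carrier_mat m m" "k \<le> m"
  shows "leading_submatrix k A = mat k k (\<lambda>(i, j). A $$ (i, j))"
proof -
  have set: "{i. i < m \<and> i \<in> {..<k}} = {..<k}" using assms by auto
  have pick: "pick {..<k} i = i" if "i < k" for i
  proof -
    have "{a. a < k \<and> a \<in> UNIV} = {..<k}" by auto
    thus ?thesis using pick_reduce_set[of i k UNIV] that by (simp add: pick_UNIV)
  qed
  show ?thesis using assms unfolding leading_submatrix_def submatrix_def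
    by (auto simp: set[unfolded lessThan_iff] pick intro!: eq_matI)
qed

text \<open>
  An eigenvector of the leading submatrix, extended by a zero, satisfies the first \<open>N\<close> rows of the eigenvector
  equation of the full matrix, and conversely. The zero in the last place removes the corner terms.
\<close>

lemma spectrum_leading_submatrix_hat_J:
  fixes c b :: "nat \<Rightarrow> real"
  assumes N: "N \<ge> 2" and b: "\<And>j. j \<in> {1..N} \<Longrightarrow> b j \<noteq> 0"
  shows "spectrum (leading_submatrix N (hat_J (Suc N) c b a bn)) =
    {x. poly (jacobi_poly (\<lambda>j. of_real (c j)) (\<lambda>j. of_real ((b j)\<^sup>2)) N) x = 0}"
proof -
  define J where "J = hat_J (Suc N) c b a bn"
  have J: "J \<in> carrier_mat (Suc N) (Suc N)" by (simp add: J_def hat_J_def)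
  define T where "T = leading_submatrix N J"
  have T: "T = mat N N (\<lambda>(i, j). J $$ (i, j))"
    unfolding T_def by (rule leading_submatrix_eq[OF J]) simp
  have dim: "dim_row T = N" "dim_col T = N" by (simp_all add: T)
  define B where "B k = (\<Prod>j = 1..k. complex_of_real (b j))" for k
  have B: "B k \<noteq> 0" if "k \<le> N" for k using that b by (auto simp: B_def)
  define C D where "C = (\<lambda>j. complex_of_real (c j))" and "D = (\<lambda>j. complex_of_real ((b j)\<^sup>2))"
  have Tv: "(T *\<^sub>v w) $ k = (J *\<^sub>v v) $ k"
    if "w \<in> carrier_vec N" "v \<in> carrier_vec (Suc N)" "\<And>i. i < N \<Longrightarrow> v $ i = w $ i" "v $ N = 0" "k < N"
    for v w k
    using that J by (simp add: T scalar_prod_def)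
  have "eigenvalue T x \<longleftrightarrow> poly (jacobi_poly C D N) x = 0" for x
  proof -
    define R S where "R k = poly (jacobi_poly C D k) x" and "S k = poly (assoc_poly C D k) x" for k
    have RS: "R 0 = 1" "S 0 = 0" by (simp_all add: R_def S_def)
    have interior: "(\<forall>k<N. (J *\<^sub>v v) $ k = x * v $ k) \<longleftrightarrow>
      (\<forall>k\<le>N. B k * v $ k = R k * v $ 0)" if "v \<in> carrier_vec (Suc N)" "v $ N = 0" for v
      using hat_J_interior_rows[OF N that(1) b] that(2) unfolding J_def B_def R_def S_def C_def D_def
      by simp
    show ?thesis
    proof
      assume "eigenvalue T x"
      then obtain w where w: "w \<in> carrier_vec N" "w \<noteq> 0\<^sub>v N" "T *\<^sub>v w = x \<cdot>\<^sub>v w"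
        by (auto simp: eigenvalue_def eigenvector_def dim)
      define v where "v = vec (Suc N) (\<lambda>i. if i < N then w $ i else 0)"
      have v: "v \<in> carrier_vec (Suc N)" "\<And>i. i < N \<Longrightarrow> v $ i = w $ i" "v $ N = 0"
        by (simp_all add: v_def)
      have "(J *\<^sub>v v) $ k = x * v $ k" if "k < N" for k
        using Tv[OF w(1) v that] w v that by simp
      hence F: "\<forall>k\<le>N. B k * v $ k = R k * v $ 0" using interior[OF v(1,3)] by auto
      have "v $ 0 \<noteq> 0"
      proof
        assume "v $ 0 = 0"
        hence "w $ k = 0" if "k < N" for k
          using F[rule_format, of k] B[of k] that v(2)[of k] by simp
        hence "w = 0\<^sub>v N" using w(1) by (intro eq_vecI) auto
        with w(2) show False ..
      qed
      thus "poly (jacobi_poly C D N) x = 0" using F[rule_format, of N] v(3) by (simp add: R_def)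
    next
      assume "poly (jacobi_poly C D N) x = 0"
      hence RN: "R N = 0" by (simp add: R_def)
      define v where "v = vec (Suc N) (\<lambda>k. R k / B k)"
      define w where "w = vec N (\<lambda>k. R k / B k)"
      have v: "v \<in> carrier_vec (Suc N)" "\<And>i. i < N \<Longrightarrow> v $ i = w $ i" "v $ N = 0"
        by (simp_all add: v_def w_def RN)
      have w: "w \<in> carrier_vec N" by (simp add: w_def)
      have v0: "v $ 0 = 1" by (simp add: v_def RS B_def)
      have "\<forall>k\<le>N. B k * v $ k = R k * v $ 0" unfolding v0 using B by (simp add: v_def)
      hence "(J *\<^sub>v v) $ k = x * v $ k" if "k < N" for k using interior[OF v(1,3)] that by auto
      hence "(T *\<^sub>v w) $ k = x * w $ k" if "k < N" for k using Tv[OF w v that] that v(2) by simp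
      hence "T *\<^sub>v w = x \<cdot>\<^sub>v w" using w dim by (intro eq_vecI) (auto simp del: index_mult_mat_vec)
      moreover have "w \<noteq> 0\<^sub>v N"
      proof
        assume "w = 0\<^sub>v N"
        hence "w $ 0 = 0" using N by simp
        with v(2)[of 0] v0 N show False by simp
      qed
      ultimately show "eigenvalue T x"
        using w by (auto simp: eigenvalue_def eigenvector_def dim)
    qed
  qed
  thus ?thesis unfolding spectrum_def T_def J_def C_def D_def by blast
qed

section \<open>Solutions and their weights\<close>

lemma poly_of_real_periodic:
  "poly (periodic_poly (\<lambda>i. of_real (c i)) (\<lambda>i. of_real (d i)) (of_real a) (of_real g) (of_real s) N)
      (of_real x) = (of_real (poly (periodic_poly c d a g s N) x) :: 'a :: {real_field})"
  by (simp add: periodic_poly_def poly_of_real_jacobi poly_of_real_assoc)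

text \<open>
  The key identity. At a root of the polynomial of the leading submatrix, the two diagonal cofactor terms have
  sum \<open>P(x) + s\<close>, where \<open>P\<close> is the characteristic polynomial, and by \<open>casoratian\<close> their product is
  \<open>g d\<^sub>1 \<cdots> d\<^sub>N\<close>, a prescribed quantity. So \<open>t\<close>, being one of them, solves a quadratic equation with known
  coefficients.
\<close>

lemma periodic_poly_at_node:
  assumes "poly (jacobi_poly c d (Suc M)) x = 0"
  defines "t \<equiv> - (d (Suc M)) * poly (jacobi_poly c d M) x"
  shows "t\<^sup>2 - (poly (periodic_poly c d a g s (Suc M)) x + s) * t + g * (\<Prod>j = 1..Suc M. d j) = 0"
proof -
  let ?R = "poly (jacobi_poly c d M) x" and ?S = "poly (assoc_poly c d (Suc M)) x"
  have cas: "?S * ?R = (\<Prod>j = 1..M. d j)"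
    using arg_cong[OF casoratian[of c d M], of "\<lambda>p. poly p x"] assms(1) by simp
  have per: "poly (periodic_poly c d a g s (Suc M)) x + s = t - g * ?S"
    using assms(1) by (simp add: periodic_poly_def t_def)
  have "t\<^sup>2 - (t - g * ?S) * t + g * (\<Prod>j = 1..Suc M. d j)
      = g * d (Suc M) * ((\<Prod>j = 1..M. d j) - ?S * ?R)"
    by (simp add: t_def power2_eq_square algebra_simps)
  thus ?thesis unfolding per cas by simp
qed

text \<open>
  A monic polynomial of degree \<open>card S\<close> with \<open>card S\<close> distinct prescribed roots is determined, so that prescribing
  the spectrum as a set fixes the characteristic polynomial.
\<close>

lemma roots_eq_of_real_image_iff:
  fixes p :: "'a :: real_field poly" and q :: "real poly"
  assumes S: "finite S" "inj_on lam S"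
    and p: "degree p = card S" "lead_coeff p = 1"
    and q: "degree q = card S" "lead_coeff q = 1"
    and pq: "\<And>x. poly p (of_real x) = of_real (poly q x)"
  shows "{x. poly p x = 0} = of_real ` lam ` S \<longleftrightarrow> q = (\<Prod>j\<in>S. [:- lam j, 1:])"
proof
  assume roots: "{x. poly p x = 0} = of_real ` lam ` S"
  show "q = (\<Prod>j\<in>S. [:- lam j, 1:])"
  proof (rule monic_eq_prod_linear[OF S q])
    fix k assume "k \<in> S"
    hence "poly p (of_real (lam k)) = 0" using roots by blast
    thus "poly q (lam k) = 0" using pq by simp
  qed
next
  assume q_eq: "q = (\<Prod>j\<in>S. [:- lam j, 1:])"
  have "p = (\<Prod>j\<in>S. [:- (of_real (lam j)), 1:])"
  proof (rule monic_eq_prod_linear[OF S(1) _ p])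
    show "inj_on (\<lambda>j. of_real (lam j) :: 'a) S" using S(2) by (simp add: inj_on_def)
    fix k assume "k \<in> S"
    hence "(\<Prod>j\<in>S. lam k - lam j) = 0" using S(1) by (intro prod_zero) auto
    thus "poly p (of_real (lam k)) = 0" by (simp add: pq q_eq poly_prod)
  qed
  thus "{x. poly p x = 0} = of_real ` lam ` S"
    using S(1) by (auto simp: poly_prod)
qed

lemma hat_J_cong:
  assumes "\<And>k. k \<in> {1..N} \<Longrightarrow> c k = c' k" "\<And>k. k \<in> {1..N} \<Longrightarrow> b k = b' k"
  shows "hat_J (Suc N) c b a bn = hat_J (Suc N) c' b' a bn"
  using assms by (intro eq_matI) (auto simp: hat_J_def Let_def)

text \<open>
  The contribution \<open>b\<^sub>N\<^sup>2 P\<^sub>N\<^sub>-\<^sub>1(\<mu>\<^sub>k)\<close> of the last off-diagonal entry to the characteristic polynomial at \<open>\<mu>\<^sub>k\<close>, with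
  the sign that makes it positive. The parameters are read off from the entries of the matrix, which makes
  it a function of the matrix.
\<close>

definition weight :: "nat \<Rightarrow> (nat \<Rightarrow> real) \<Rightarrow> complex mat \<Rightarrow> nat \<Rightarrow> real" where
  "weight N mu J k = (-1) ^ (N - k) * (Re (J $$ (N - 1, N)))\<^sup>2 *
     poly (jacobi_poly (\<lambda>j. Re (J $$ (j - 1, j - 1))) (\<lambda>j. (Re (J $$ (j - 1, j)))\<^sup>2) (N - 1)) (mu k)"

lemma hat_J_superdiagonal:
  assumes "k \<in> {1..N}"
  shows "hat_J (Suc N) c b a bn $$ (k - 1, k) = of_real (b k)"
  using assms by (auto simp: hat_J_def Let_def)

lemma weight_hat_J:
  assumes "N \<ge> 1"
  shows "weight N mu (hat_J (Suc N) c b a bn) k =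
    (-1) ^ (N - k) * (b N)\<^sup>2 * poly (jacobi_poly c (\<lambda>j. (b j)\<^sup>2) (N - 1)) (mu k)"
proof -
  have "jacobi_poly (\<lambda>j. Re (hat_J (Suc N) c b a bn $$ (j - 1, j - 1)))
      (\<lambda>j. (Re (hat_J (Suc N) c b a bn $$ (j - 1, j)))\<^sup>2) (N - 1) = jacobi_poly c (\<lambda>j. (b j)\<^sup>2) (N - 1)"
    by (rule jacobi_poly_cong) (auto simp: hat_J_def Let_def)
  thus ?thesis using hat_J_superdiagonal[of N N c b a bn] assms by (simp add: weight_def)
qed

text \<open>
  The matrices have size \<open>n = N + 1\<close>, and their leading submatrices have size \<open>N\<close>.
\<close>

locale spectral_data =
  fixes N :: nat and lam mu :: "nat \<Rightarrow> real" and \<beta> :: complex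
  assumes N: "N \<ge> 2" and nonreal: "\<beta> \<notin> \<real>"
    and mu: "strict_mono_on {1..N} mu" and lam: "inj_on lam {1..Suc N}"
    and disjoint: "mu ` {1..N} \<inter> lam ` {1..Suc N} = {}"
begin

definition realizes :: "(nat \<Rightarrow> real) \<Rightarrow> (nat \<Rightarrow> real) \<Rightarrow> real \<Rightarrow> complex \<Rightarrow> bool" where
  "realizes c b a bn \<longleftrightarrow> (\<Prod>k = 1..N. of_real (b k)) * bn = \<beta> \<and>
     jacobi_poly c (\<lambda>j. (b j)\<^sup>2) N = (\<Prod>j = 1..N. [:- mu j, 1:]) \<and>
     periodic_poly c (\<lambda>j. (b j)\<^sup>2) a ((cmod bn)\<^sup>2) (2 * Re \<beta>) N = (\<Prod>j = 1..Suc N. [:- lam j, 1:])"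

text \<open>
  The sum of the two roots of the quadratic equation for the weight at \<open>\<mu>\<^sub>k\<close>; their product is \<open>\<bar>\<beta>\<bar>\<^sup>2\<close>.
\<close>

definition root_sum :: "nat \<Rightarrow> real" where
  "root_sum k = (-1) ^ (Suc N - k) * (chi (Suc N) lam (mu k) + 2 * Re \<beta>)"

definition admissible :: "nat \<Rightarrow> real set" where
  "admissible k = {u. u > 0 \<and> u\<^sup>2 - root_sum k * u + (cmod \<beta>)\<^sup>2 = 0}"

lemma inj_mu: "inj_on mu {1..N}"
  using mu by (rule strict_mono_on_imp_inj_on)

lemma beta_nonzero: "\<beta> \<noteq> 0"
  using nonreal by auto

lemma prod_beta_nonzero:
  assumes "(\<Prod>k = 1..N. complex_of_real (b k)) * bn = \<beta>" "k \<in> {1..N}"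
  shows "b k \<noteq> 0"
proof
  assume "b k = 0"
  hence "(\<Prod>k = 1..N. complex_of_real (b k)) = 0" using assms(2) by (intro prod_zero) auto
  with assms(1) beta_nonzero show False by (metis mult_zero_left)
qed

lemma poly_lam: "poly (\<Prod>j = 1..Suc N. [:- lam j, 1:]) x = chi (Suc N) lam x"
  by (simp add: chi_def poly_prod del: prod.cl_ivl_Suc)

lemma poly_mu_zero: "k \<in> {1..N} \<Longrightarrow> poly (\<Prod>j = 1..N. [:- mu j, 1:]) (mu k) = 0"
  by (auto simp: poly_prod)

text \<open>
  Both spectra consist of as many distinct numbers as the size of the matrix, so they amount to equations
  between polynomials. The entry \<open>a\<close>, a priori complex, is real: at \<open>\<lambda>\<^sub>1\<close> the characteristic polynomial vanishes,
  all its other ingredients are real, and the factor of \<open>a\<close> is not zero because \<open>\<lambda>\<^sub>1\<close> is not among the \<open>\<mu>\<^sub>k\<close>.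
\<close>

lemma solutions_eq:
  "solutions (Suc N) lam mu \<beta> = {J. \<exists>c b a bn. J = hat_J (Suc N) c b (of_real a) bn \<and> realizes c b a bn}"
proof -
  let ?spec = "\<lambda>J. spectrum J = complex_of_real ` lam ` {1..Suc N} \<and>
    spectrum (leading_submatrix N J) = complex_of_real ` mu ` {1..N}"
  have iff: "?spec (hat_J (Suc N) c b (of_real a) bn) \<longleftrightarrow> realizes c b a bn"
    and real: "?spec (hat_J (Suc N) c b a' bn) \<Longrightarrow> a' \<in> \<real>"
    if prod: "(\<Prod>k = 1..N. of_real (b k)) * bn = \<beta>" for c b a a' bn
  proof -
    have b: "b j \<noteq> 0" if "j \<in> {1..N}" for j using prod_beta_nonzero[OF prod that] .
    define C D where "C = (\<lambda>j. complex_of_real (c j))" and "D = (\<lambda>j. complex_of_real ((b j)\<^sup>2))"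
    have N1: "1 \<le> N" using N by simp
    have spec: "spectrum (hat_J (Suc N) c b z bn) =
        {x. poly (periodic_poly C D z (of_real ((cmod bn)\<^sup>2)) (of_real (2 * Re \<beta>)) N) x = 0}" for z
      using spectrum_hat_J[OF N, where b = b and c = c and a = z and bn = bn, unfolded prod] b
      unfolding C_def D_def by blast
    have "spectrum (leading_submatrix N (hat_J (Suc N) c b z bn)) =
        {x. poly (jacobi_poly C D N) x = 0}" for z
      using spectrum_leading_submatrix_hat_J[OF N, where b = b] b unfolding C_def D_def by blast
    moreover have "{x. poly (jacobi_poly C D N) x = 0} = of_real ` mu ` {1..N} \<longleftrightarrow>
        jacobi_poly c (\<lambda>j. (b j)\<^sup>2) N = (\<Prod>j = 1..N. [:- mu j, 1:])"
      unfolding C_def D_def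
      by (rule roots_eq_of_real_image_iff[OF _ inj_mu])
        (use jacobi_poly_monic in \<open>simp_all add: poly_of_real_jacobi del: of_real_power\<close>)
    ultimately have lead: "spectrum (leading_submatrix N (hat_J (Suc N) c b z bn))
        = of_real ` mu ` {1..N} \<longleftrightarrow>
        jacobi_poly c (\<lambda>j. (b j)\<^sup>2) N = (\<Prod>j = 1..N. [:- mu j, 1:])" for z
      by simp
    have "spectrum (hat_J (Suc N) c b (of_real a) bn) = of_real ` lam ` {1..Suc N} \<longleftrightarrow>
        periodic_poly c (\<lambda>j. (b j)\<^sup>2) a ((cmod bn)\<^sup>2) (2 * Re \<beta>) N = (\<Prod>j = 1..Suc N. [:- lam j, 1:])"
      unfolding spec unfolding C_def D_def
      by (rule roots_eq_of_real_image_iff[OF _ lam])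
        (use periodic_poly_monic[OF N1] in \<open>simp_all add: poly_of_real_periodic del: of_real_power of_real_mult\<close>)
    thus "?spec (hat_J (Suc N) c b (of_real a) bn) \<longleftrightarrow> realizes c b a bn"
      unfolding lead realizes_def using prod by blast
    assume "?spec (hat_J (Suc N) c b a' bn)"
    hence R: "jacobi_poly c (\<lambda>j. (b j)\<^sup>2) N = (\<Prod>j = 1..N. [:- mu j, 1:])"
      and root: "poly (periodic_poly C D a' (of_real ((cmod bn)\<^sup>2)) (of_real (2 * Re \<beta>)) N)
        (of_real (lam 1)) = 0"
      using lead spec by auto
    define r where "r = poly (jacobi_poly c (\<lambda>j. (b j)\<^sup>2) N) (lam 1)"
    have "lam 1 \<in> lam ` {1..Suc N}" by simp
    hence "lam 1 \<noteq> mu j" if "j \<in> {1..N}" for j using disjoint that by blast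
    hence r: "r \<noteq> 0" by (auto simp: r_def R poly_prod)
    have "a' * of_real r = of_real (lam 1 * r
        - (cmod bn)\<^sup>2 * poly (assoc_poly c (\<lambda>j. (b j)\<^sup>2) N) (lam 1)
        - (b N)\<^sup>2 * poly (jacobi_poly c (\<lambda>j. (b j)\<^sup>2) (N - 1)) (lam 1) - 2 * Re \<beta>)"
      using root unfolding periodic_poly_def C_def D_def r_def
      by (simp add: poly_of_real_jacobi poly_of_real_assoc algebra_simps del: of_real_power)
    hence "a' = of_real (lam 1 * r
        - (cmod bn)\<^sup>2 * poly (assoc_poly c (\<lambda>j. (b j)\<^sup>2) N) (lam 1)
        - (b N)\<^sup>2 * poly (jacobi_poly c (\<lambda>j. (b j)\<^sup>2) (N - 1)) (lam 1) - 2 * Re \<beta>) / of_real r"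
      using r by (simp add: eq_divide_eq)
    thus "a' \<in> \<real>" by (metis Reals_divide Reals_of_real)
  qed
  show ?thesis
  proof (intro equalityI subsetI)
    fix J assume "J \<in> solutions (Suc N) lam mu \<beta>"
    then obtain c b a bn where J: "J = hat_J (Suc N) c b a bn" and
      prod: "(\<Prod>k = 1..N. complex_of_real (b k)) * bn = \<beta>" and spec: "?spec J"
      by (auto simp: solutions_def)
    have "a \<in> \<real>" using real[OF prod] spec J by simp
    then obtain r where a: "a = of_real r" by (elim Reals_cases)
    have "realizes c b r bn" using iff[OF prod, of c r] spec unfolding J a by blast
    thus "J \<in> {J. \<exists>c b a bn. J = hat_J (Suc N) c b (of_real a) bn \<and> realizes c b a bn}"
      unfolding J a by (intro CollectI exI[of _ c] exI[of _ b] exI[of _ r] exI[of _ bn] conjI) simp_all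
  next
    fix J assume "J \<in> {J. \<exists>c b a bn. J = hat_J (Suc N) c b (of_real a) bn \<and> realizes c b a bn}"
    then obtain c b a bn where J: "J = hat_J (Suc N) c b (of_real a) bn" and r: "realizes c b a bn"
      by blast
    have prod: "(\<Prod>k = 1..N. complex_of_real (b k)) * bn = \<beta>" using r by (simp add: realizes_def)
    hence "bn \<noteq> 0" using beta_nonzero by auto
    moreover have "?spec J" using iff[OF prod, of c a] r unfolding J by blast
    ultimately show "J \<in> solutions (Suc N) lam mu \<beta>"
      unfolding solutions_def J diff_Suc_1 using prod
      by (intro CollectI conjI exI[of _ c] exI[of _ b] exI[of _ "of_real a"] exI[of _ bn] refl) blast+
  qed
qed

lemma realizes_nonzero:
  assumes "realizes c b a bn"
  shows "k \<in> {1..N} \<Longrightarrow> b k \<noteq> 0" "(cmod bn)\<^sup>2 * (\<Prod>j = 1..N. (b j)\<^sup>2) = (cmod \<beta>)\<^sup>2"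
proof -
  have prod: "(\<Prod>k = 1..N. complex_of_real (b k)) * bn = \<beta>"
    using assms by (simp add: realizes_def)
  show "b k \<noteq> 0" if "k \<in> {1..N}" using prod_beta_nonzero[OF prod that] .
  have "cmod \<beta> = (\<Prod>j = 1..N. \<bar>b j\<bar>) * cmod bn"
    unfolding prod[symmetric] by (simp add: norm_mult prod_norm[symmetric])
  thus "(cmod bn)\<^sup>2 * (\<Prod>j = 1..N. (b j)\<^sup>2) = (cmod \<beta>)\<^sup>2"
    by (simp add: power_mult_distrib prod_power_distrib mult.commute)
qed

text \<open>
  Positivity comes from \<open>wronskian_pos\<close> and the sign of the derivative at \<open>\<mu>\<^sub>k\<close>, the quadratic equation from
  \<open>periodic_poly_at_node\<close>.
\<close>

lemma weight_admissible:
  assumes J: "J \<in> solutions (Suc N) lam mu \<beta>" and k: "k \<in> {1..N}"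
  shows "weight N mu J k \<in> admissible k"
proof -
  obtain c b a bn where J: "J = hat_J (Suc N) c b (of_real a) bn" and r: "realizes c b a bn"
    using J solutions_eq by auto
  obtain M where M: "N = Suc M" using N by (cases N) auto
  define d where "d = (\<lambda>j. (b j)\<^sup>2)"
  have d: "d j > 0" if "j \<in> {1..N}" for j using realizes_nonzero(1)[OF r that] by (simp add: d_def)
  have R: "jacobi_poly c d (Suc M) = (\<Prod>j = 1..N. [:- mu j, 1:])"
    using r by (simp add: realizes_def d_def flip: M)
  define q where "q = poly (jacobi_poly c d M) (mu k)"
  have w: "weight N mu J k = (-1) ^ (N - k) * d N * q"
    using weight_hat_J[of N mu c b a bn k] N by (simp add: J q_def d_def M)
  have root: "poly (jacobi_poly c d (Suc M)) (mu k) = 0" unfolding R by (rule poly_mu_zero[OF k])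
  have deriv: "poly (pderiv (jacobi_poly c d (Suc M))) (mu k) = (\<Prod>j\<in>{1..N} - {k}. mu k - mu j)"
  proof -
    have "poly (pderiv (jacobi_poly c d (Suc M))) (mu k) = (\<Sum>i\<in>{1..N}. \<Prod>j\<in>{1..N} - {i}. mu k - mu j)"
      unfolding R pderiv_prod by (simp add: poly_sum poly_prod pderiv_pCons)
    also have "\<dots> = (\<Sum>i\<in>{k}. \<Prod>j\<in>{1..N} - {i}. mu k - mu j)"
      using k by (intro sum.mono_neutral_right) (auto intro!: prod_zero)
    finally show ?thesis by simp
  qed
  have "0 < (\<Prod>j\<in>{1..N} - {k}. mu k - mu j) * q"
    using wronskian_pos[of M d c "mu k"] d root by (simp add: deriv q_def M)
  moreover have "0 < (-1) ^ (N - k) * (\<Prod>j\<in>{1..N} - {k}. mu k - mu j)"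
    by (rule sign_derivative_at_node[OF mu k])
  ultimately have "0 < ((-1) ^ (N - k) * (\<Prod>j\<in>{1..N} - {k}. mu k - mu j))
      * ((\<Prod>j\<in>{1..N} - {k}. mu k - mu j) * q)" by (rule mult_pos_pos[rotated])
  also have "\<dots> = (\<Prod>j\<in>{1..N} - {k}. mu k - mu j)\<^sup>2 * ((-1) ^ (N - k) * q)"
    by (simp add: power2_eq_square)
  finally have "0 < (-1) ^ (N - k) * q" by (simp add: zero_less_mult_iff)
  hence "0 < d N * ((-1) ^ (N - k) * q)" using d[of N] N by (intro mult_pos_pos[of "d N"]) auto
  hence pos: "0 < weight N mu J k" unfolding w by (simp add: mult_ac)
  define \<sigma> :: real where "\<sigma> = (-1) ^ (N - k)"
  have \<sigma>: "\<sigma> * \<sigma> = 1" by (simp add: \<sigma>_def flip: power_mult_distrib)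
  have E: "root_sum k = - \<sigma> * (chi (Suc N) lam (mu k) + 2 * Re \<beta>)"
    using k by (simp add: root_sum_def \<sigma>_def Suc_diff_le)
  have per: "poly (periodic_poly c d a ((cmod bn)\<^sup>2) (2 * Re \<beta>) N) (mu k) = chi (Suc N) lam (mu k)"
    using r poly_lam by (simp add: realizes_def d_def del: prod.cl_ivl_Suc)
  have norm: "(cmod bn)\<^sup>2 * (\<Prod>j = 1..N. d j) = (cmod \<beta>)\<^sup>2"
    using realizes_nonzero(2)[OF r] by (simp add: d_def)
  have "(- (d N) * q)\<^sup>2 - (chi (Suc N) lam (mu k) + 2 * Re \<beta>) * (- (d N) * q) + (cmod \<beta>)\<^sup>2 = 0"
    using periodic_poly_at_node[OF root, of a "(cmod bn)\<^sup>2" "2 * Re \<beta>"]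
    unfolding M[symmetric] norm per q_def[symmetric] .
  moreover have "(weight N mu J k)\<^sup>2 - root_sum k * weight N mu J k
      = (\<sigma> * \<sigma>) * ((d N * q)\<^sup>2 + (chi (Suc N) lam (mu k) + 2 * Re \<beta>) * (d N * q))"
    unfolding w E \<sigma>_def[symmetric] by (simp add: algebra_simps power2_eq_square)
  ultimately show ?thesis using pos unfolding \<sigma> by (simp add: admissible_def)
qed

end

section \<open>Admissible weights and positive solutions\<close>

text \<open>
  Product and sum of the roots are \<open>r\<^sup>2 > 0\<close> and \<open>E\<close>, so real roots are positive for \<open>E > 0\<close> and negative for
  \<open>E < 0\<close>; they exist if and only if the discriminant \<open>E\<^sup>2 - 4 r\<^sup>2\<close> is nonnegative.
\<close>

lemma card_positive_roots:
  fixes E r :: real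
  assumes r: "r > 0"
  shows "card {u. u > 0 \<and> u\<^sup>2 - E * u + r\<^sup>2 = 0} = (if E < 2 * r then 0 else if E = 2 * r then 1 else 2)"
proof -
  consider "E < 2 * r" | "E = 2 * r" | "E > 2 * r" by linarith
  thus ?thesis
  proof cases
    case 1
    have "u\<^sup>2 - E * u + r\<^sup>2 > 0" if "u > 0" for u
    proof -
      have "u\<^sup>2 - E * u + r\<^sup>2 = (u - r)\<^sup>2 + (2 * r - E) * u"
        by (simp add: power2_eq_square algebra_simps)
      also have "\<dots> > 0" using 1 that by (intro add_nonneg_pos mult_pos_pos) auto
      finally show ?thesis .
    qed
    hence empty: "{u. u > 0 \<and> u\<^sup>2 - E * u + r\<^sup>2 = 0} = {}" by force
    show ?thesis unfolding empty using 1 by simp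
  next
    case 2
    have "u\<^sup>2 - E * u + r\<^sup>2 = (u - r)\<^sup>2" for u
      using 2 by (simp add: power2_eq_square algebra_simps)
    hence "{u. u > 0 \<and> u\<^sup>2 - E * u + r\<^sup>2 = 0} = {r}" using r by auto
    thus ?thesis using 2 by simp
  next
    case 3
    define D where "D = sqrt (E\<^sup>2 - (2 * r)\<^sup>2)"
    have "(2 * r)\<^sup>2 < E\<^sup>2" using 3 r by (intro power_strict_mono) auto
    hence D: "D > 0" "D\<^sup>2 = E\<^sup>2 - 4 * r\<^sup>2" by (auto simp: D_def power_mult_distrib)
    have "D < E" using D(2) 3 r by (intro power2_less_imp_less[of D E]) auto
    have "u\<^sup>2 - E * u + r\<^sup>2 = (u - (E + D) / 2) * (u - (E - D) / 2)" for u
      using D(2) by (simp add: field_simps power2_eq_square)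
    hence "{u. u > 0 \<and> u\<^sup>2 - E * u + r\<^sup>2 = 0} = {(E + D) / 2, (E - D) / 2}"
      using D \<open>D < E\<close> by auto
    thus ?thesis using 3 D(1) by simp
  qed
qed

lemma abs_Re_less_cmod: "z \<notin> \<real> \<Longrightarrow> \<bar>Re z\<bar> < cmod z"
proof (rule power2_less_imp_less)
  assume "z \<notin> \<real>"
  hence "(Im z)\<^sup>2 > 0" by (simp add: complex_is_Real_iff)
  thus "\<bar>Re z\<bar>\<^sup>2 < (cmod z)\<^sup>2" by (simp add: cmod_power2)
qed simp

text \<open>
  The two inequalities of the theorem at a single \<open>\<mu>\<^sub>k\<close> say the same as one: because \<open>\<bar>x\<bar> < r\<close>, the value \<open>\<sigma> X\<close>
  is positive when \<open>\<sigma> (X + 2 x) \<ge> 2 r\<close> and negative when \<open>\<sigma> (X + 2 x) \<le> - 2 r\<close>.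
  For \<open>x = Re \<beta>\<close> and \<open>r = \<bar>\<beta>\<bar>\<close> the strict bound says that \<open>\<beta>\<close> is not real.
\<close>

lemma strict_sign_condition:
  fixes \<sigma> X x r :: real
  assumes "\<bar>x\<bar> < r" "\<sigma> \<in> {1, -1}"
  shows "\<sigma> * X > 0 \<and> \<bar>X + 2 * x\<bar> \<ge> 2 * r \<longleftrightarrow> \<sigma> * (X + 2 * x) \<ge> 2 * r"
    and "\<sigma> * (X + 2 * x) \<ge> 2 * r \<Longrightarrow> \<bar>X + 2 * x\<bar> = 2 * r \<longleftrightarrow> \<sigma> * (X + 2 * x) = 2 * r"
  using assms by auto

context spectral_data
begin

lemma positive_solutions_eq:
  "positive_solutions (Suc N) lam mu \<beta> = {J. \<exists>c b a bn. J = hat_J (Suc N) c b (of_real a) bn \<and>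
     realizes c b a bn \<and> (\<forall>k\<in>{1..N}. b k > 0)}"
proof -
  have pos: "(\<forall>k\<in>{1..N}. Re (hat_J (Suc N) c b a bn $$ (k - 1, k)) > 0) \<longleftrightarrow> (\<forall>k\<in>{1..N}. b k > 0)"
    for c b a bn
    by (intro ball_cong refl) (simp only: hat_J_superdiagonal Re_complex_of_real)
  show ?thesis
  proof (intro equalityI subsetI)
    fix J assume "J \<in> positive_solutions (Suc N) lam mu \<beta>"
    then obtain c b a bn where J: "J = hat_J (Suc N) c b (of_real a) bn" and r: "realizes c b a bn"
      and p: "\<forall>k\<in>{1..N}. Re (J $$ (k - 1, k)) > 0"
      unfolding positive_solutions_def solutions_eq diff_Suc_1 by blast
    have "\<forall>k\<in>{1..N}. b k > 0" using p unfolding J pos .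
    with J r show "J \<in> {J. \<exists>c b a bn. J = hat_J (Suc N) c b (of_real a) bn \<and>
      realizes c b a bn \<and> (\<forall>k\<in>{1..N}. b k > 0)}" by blast
  next
    fix J assume "J \<in> {J. \<exists>c b a bn. J = hat_J (Suc N) c b (of_real a) bn \<and>
      realizes c b a bn \<and> (\<forall>k\<in>{1..N}. b k > 0)}"
    then obtain c b a bn where J: "J = hat_J (Suc N) c b (of_real a) bn" and r: "realizes c b a bn"
      and "\<forall>k\<in>{1..N}. b k > 0" by blast
    hence "\<forall>k\<in>{1..N}. Re (J $$ (k - 1, k)) > 0" unfolding J pos by blast
    with J r show "J \<in> positive_solutions (Suc N) lam mu \<beta>"
      unfolding positive_solutions_def solutions_eq diff_Suc_1 by blast
  qed
qed

text \<open>
  With its sign restored, an admissible weight solves the equation that \<open>periodic_poly_at_node\<close> yields for the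
  value of the characteristic polynomial at \<open>\<mu>\<^sub>k\<close>; comparing the two equations identifies this value.
\<close>

lemma admissible_signed_root:
  assumes "k \<in> {1..N}" and u: "u \<in> admissible k"
  shows "(- ((-1) ^ (N - k) * u))\<^sup>2
    - (chi (Suc N) lam (mu k) + 2 * Re \<beta>) * (- ((-1) ^ (N - k) * u)) + (cmod \<beta>)\<^sup>2 = 0"
proof -
  define \<sigma> :: real where "\<sigma> = (-1) ^ (N - k)"
  have \<sigma>: "\<sigma>\<^sup>2 = 1" by (simp add: \<sigma>_def flip: power_mult)
  have E: "root_sum k = - \<sigma> * (chi (Suc N) lam (mu k) + 2 * Re \<beta>)"
    using assms by (simp add: root_sum_def \<sigma>_def Suc_diff_le)
  have "(- (\<sigma> * u))\<^sup>2 - (chi (Suc N) lam (mu k) + 2 * Re \<beta>) * (- (\<sigma> * u)) + (cmod \<beta>)\<^sup>2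
      = \<sigma>\<^sup>2 * u\<^sup>2 - root_sum k * u + (cmod \<beta>)\<^sup>2"
    unfolding E by (simp add: power_mult_distrib algebra_simps)
  thus ?thesis using u unfolding \<sigma> admissible_def \<sigma>_def[symmetric] by simp
qed

text \<open>
  Prescribed weights fix the values at all \<open>\<mu>\<^sub>k\<close> of a polynomial of degree below \<open>N\<close>. Its leading coefficient is
  positive and gives \<open>b\<^sub>N\<^sup>2\<close>; the monic multiple is the required \<open>P\<^sub>N\<^sub>-\<^sub>1\<close>, and \<open>jacobi_exists\<close> provides the Jacobi
  matrix. Then \<open>b\<^sub>n\<close> is determined by \<open>\<beta>\<close>. The characteristic polynomial takes the right values at all \<open>\<mu>\<^sub>k\<close>,
  since the quadratic equation can be solved for them, and the remaining freedom, a multiple of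
  \<open>\<Prod>(x - \<mu>\<^sub>k)\<close>, is absorbed by \<open>a\<close>.
\<close>

lemma positive_solution_exists:
  assumes u: "\<And>k. k \<in> {1..N} \<Longrightarrow> u k \<in> admissible k"
  obtains J where "J \<in> positive_solutions (Suc N) lam mu \<beta>"
    "\<And>k. k \<in> {1..N} \<Longrightarrow> weight N mu J k = u k"
proof -
  obtain M where M: "N = Suc M" using N by (cases N) auto
  define p where "p = (\<Prod>j = 1..N. [:- mu j, 1:])"
  have p: "degree p = N" "coeff p N = 1"
    using prod_linear_monic[of "{1..N}" mu] by (auto simp: p_def)
  have u_pos: "u k > 0" if "k \<in> {1..N}" for k using u[OF that] by (simp add: admissible_def)
  have "card {1..N} = Suc M" by (simp add: M)
  from lagrange_interpolation[OF _ inj_mu this, of "\<lambda>k. (-1) ^ (N - k) * u k"] obtain f where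
    f: "degree f \<le> M" "\<And>k. k \<in> {1..N} \<Longrightarrow> poly f (mu k) = (-1) ^ (N - k) * u k" by auto
  define B where "B = coeff f M"
  have B: "B > 0"
    unfolding B_def using mu f u_pos
    by (intro alternating_lead_coeff_pos[of M mu]) (auto simp: M simp flip: mult.assoc power_mult_distrib)
  have "degree f = M" using B f(1) le_degree[of f M] by (auto simp: B_def)
  define q where "q = smult (1 / B) f"
  have q: "degree q = M" "lead_coeff q = 1" using \<open>degree f = M\<close> B by (auto simp: q_def B_def)
  have q_mu: "B * poly q (mu k) = (-1) ^ (N - k) * u k" if "k \<in> {1..N}" for k
    using f(2)[OF that] B by (simp add: q_def)
  have "(-1) ^ (N - k) * poly q (mu k) > 0" if k: "k \<in> {1..N}" for k
  proof -
    have "(-1) ^ (N - k) * poly q (mu k) = u k / B"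
      using f(2)[OF k] by (simp add: q_def flip: power_mult_distrib mult.assoc)
    thus ?thesis using u_pos[OF k] B by simp
  qed
  then obtain c d where d: "\<And>j. j \<in> {1..M} \<Longrightarrow> d j > 0"
    and cd: "jacobi_poly c d N = p" "jacobi_poly c d M = q"
    using jacobi_exists[OF mu[unfolded M] q] unfolding M p_def by blast
  define b where "b j = (if j = N then sqrt B else sqrt (d j))" for j
  have b_pos: "b j > 0" if "j \<in> {1..N}" for j using that B d[of j] by (auto simp: b_def M)
  define d' where "d' = (\<lambda>j. (b j)\<^sup>2)"
  have d': "d' j = d j" if "j \<in> {1..M}" for j using that d[of j] by (simp add: d'_def b_def M)
  have dN: "d' N = B" using B by (simp add: d'_def b_def)
  have R: "jacobi_poly c d' N = p" "jacobi_poly c d' M = q"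
    unfolding cd[symmetric] by (auto intro!: jacobi_poly_cong d' simp: M)
  define P where "P = (\<Prod>k = 1..N. complex_of_real (b k))"
  have P: "P \<noteq> 0" using b_pos by (auto simp: P_def less_le)
  define bn where "bn = \<beta> / P"
  have prod: "P * bn = \<beta>" using P by (simp add: bn_def)
  have norm: "(cmod bn)\<^sup>2 * (\<Prod>j = 1..N. d' j) = (cmod \<beta>)\<^sup>2"
  proof -
    have "cmod P = (\<Prod>j = 1..N. \<bar>b j\<bar>)" by (simp add: P_def prod_norm[symmetric])
    hence "(cmod P)\<^sup>2 = (\<Prod>j = 1..N. d' j)" by (simp add: d'_def prod_power_distrib)
    thus ?thesis unfolding prod[symmetric] by (simp add: norm_mult power_mult_distrib)
  qed
  let ?L = "\<Prod>j = 1..Suc N. [:- lam j, 1:]"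
  define per where "per a = periodic_poly c d' a ((cmod bn)\<^sup>2) (2 * Re \<beta>) N" for a
  have per_root: "poly (per a) (mu k) = chi (Suc N) lam (mu k)" if k: "k \<in> {1..N}" for a k
  proof -
    define t where "t = - ((-1) ^ (N - k) * u k)"
    have t0: "t \<noteq> 0" using u_pos[OF k] by (simp add: t_def)
    have "t = - (d' (Suc M)) * poly (jacobi_poly c d' M) (mu k)"
      using q_mu[OF k] dN R(2) by (simp add: t_def M)
    moreover have "poly (jacobi_poly c d' (Suc M)) (mu k) = 0"
      using R(1) poly_mu_zero[OF k] by (simp add: p_def flip: M)
    ultimately have "t\<^sup>2 - (poly (per a) (mu k) + 2 * Re \<beta>) * t + (cmod \<beta>)\<^sup>2 = 0"
      using periodic_poly_at_node[of c d' M "mu k" a "(cmod bn)\<^sup>2" "2 * Re \<beta>"] norm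
      by (simp add: per_def flip: M)
    moreover have "t\<^sup>2 - (chi (Suc N) lam (mu k) + 2 * Re \<beta>) * t + (cmod \<beta>)\<^sup>2 = 0"
      unfolding t_def by (rule admissible_signed_root[OF k u[OF k]])
    ultimately have "(poly (per a) (mu k) + 2 * Re \<beta>) * t = (chi (Suc N) lam (mu k) + 2 * Re \<beta>) * t"
      by linarith
    thus ?thesis using t0 by simp
  qed
  \<comment> \<open>The difference \<open>?L - per 0\<close> has degree at most \<open>N\<close> and the roots \<open>\<mu>\<^sub>1, \<dots>, \<mu>\<^sub>N\<close>, so it is a multiple of \<open>p\<close>.\<close>
  define a where "a = - coeff (?L - per 0) N"
  have per_a: "per a = per 0 - smult a p"
    using R(1) by (simp add: per_def periodic_poly_def algebra_simps)
  have "?L - per 0 = smult (- a) p"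
  proof (rule poly_eqI_degree_lead_coeff[where n = N and A = "mu ` {1..N}"])
    have L: "degree ?L = Suc N" "coeff ?L (Suc N) = 1"
      using prod_linear_monic[of "{1..Suc N}" lam] by auto
    have per0: "degree (per 0) = Suc N" "coeff (per 0) (Suc N) = 1"
      using N periodic_poly_monic[of N c d' 0 "(cmod bn)\<^sup>2" "2 * Re \<beta>"] by (auto simp: per_def)
    have "coeff (?L - per 0) i = 0" if "i > N" for i
      using that L per0 by (cases "i = Suc N") (simp_all add: coeff_eq_0 del: prod.cl_ivl_Suc)
    thus "degree (?L - per 0) \<le> N" by (intro degree_le) blast
    show "poly (?L - per 0) z = poly (smult (- a) p) z" if "z \<in> mu ` {1..N}" for z
    proof -
      from that obtain k where k: "k \<in> {1..N}" "z = mu k" by blast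
      thus ?thesis using poly_mu_zero[OF k(1)] per_root[OF k(1), of 0] poly_lam
        by (simp add: p_def del: prod.cl_ivl_Suc)
    qed
  qed (use p card_image[OF inj_mu] in \<open>auto simp: a_def simp del: prod.cl_ivl_Suc\<close>)
  hence "per a = ?L" unfolding per_a by (simp add: algebra_simps del: prod.cl_ivl_Suc)
  hence r: "realizes c b a bn"
    unfolding realizes_def using prod R(1) by (simp add: P_def per_def d'_def p_def del: prod.cl_ivl_Suc)
  define J where "J = hat_J (Suc N) c b (of_real a) bn"
  have "J \<in> positive_solutions (Suc N) lam mu \<beta>"
    unfolding positive_solutions_eq using r b_pos J_def by blast
  moreover have "weight N mu J k = u k" if k: "k \<in> {1..N}" for k
  proof -
    have "weight N mu J k = (-1) ^ (N - k) * (B * poly q (mu k))"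
      using weight_hat_J[of N mu c b a bn k] N R(2) dN by (simp add: J_def M d'_def)
    also have "\<dots> = u k" unfolding q_mu[OF k] by (simp flip: power_mult_distrib mult.assoc)
    finally show ?thesis .
  qed
  ultimately show ?thesis by (rule that)
qed

text \<open>
  The weights determine the polynomial \<open>b\<^sub>N\<^sup>2 P\<^sub>N\<^sub>-\<^sub>1\<close> of degree below \<open>N\<close> by its values at \<open>N\<close> points, hence both
  factors. Together with \<open>P\<^sub>N\<close> this determines the recurrence, and positivity removes the signs of the \<open>b\<^sub>k\<close>.
\<close>

lemma positive_solution_unique:
  assumes J: "J \<in> positive_solutions (Suc N) lam mu \<beta>"
    and J': "J' \<in> positive_solutions (Suc N) lam mu \<beta>"
    and weights: "\<And>k. k \<in> {1..N} \<Longrightarrow> weight N mu J k = weight N mu J' k"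
  shows "J = J'"
proof -
  obtain M where M: "N = Suc M" using N by (cases N) auto
  obtain c b a bn where J: "J = hat_J (Suc N) c b (of_real a) bn" and r: "realizes c b a bn"
    and b: "\<forall>k\<in>{1..N}. b k > 0" using J unfolding positive_solutions_eq by blast
  obtain c' b' a' bn' where J': "J' = hat_J (Suc N) c' b' (of_real a') bn'"
    and r': "realizes c' b' a' bn'" and b': "\<forall>k\<in>{1..N}. b' k > 0"
    using J' unfolding positive_solutions_eq by blast
  define d d' where "d = (\<lambda>j. (b j)\<^sup>2)" and "d' = (\<lambda>j. (b' j)\<^sup>2)"
  have RN: "jacobi_poly c d N = jacobi_poly c' d' N"
    using r r' by (simp add: realizes_def d_def d'_def)
  have deg: "degree (smult x (jacobi_poly c d M)) < card (mu ` {1..N})" for x c d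
    using degree_smult_le[of x "jacobi_poly c d M"] card_image[OF inj_mu]
    by (simp add: jacobi_poly_monic(1) M)
  have e: "smult (d N) (jacobi_poly c d M) = smult (d' N) (jacobi_poly c' d' M)"
  proof (rule poly_eqI_degree[where A = "mu ` {1..N}"])
    show "poly (smult (d N) (jacobi_poly c d M)) z = poly (smult (d' N) (jacobi_poly c' d' M)) z"
      if "z \<in> mu ` {1..N}" for z
    proof -
      from that obtain k where k: "k \<in> {1..N}" "z = mu k" by blast
      show ?thesis using weights[OF k(1)] N k(2) unfolding J J'
        by (simp add: weight_hat_J d_def d'_def M)
    qed
  qed (rule deg)+
  have m: "coeff (jacobi_poly c d M) M = 1" "coeff (jacobi_poly c' d' M) M = 1"
    using jacobi_poly_monic[of c d M] jacobi_poly_monic[of c' d' M] by auto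
  have dN: "d N = d' N" using arg_cong[OF e, of "\<lambda>p. coeff p M"] m by simp
  have "b N > 0" using b N by simp
  hence dN0: "d N \<noteq> 0" by (simp add: d_def)
  have "smult (inverse (d N)) (smult (d N) (jacobi_poly c d M))
      = smult (inverse (d N)) (smult (d N) (jacobi_poly c' d' M))" using e dN by simp
  hence RM: "jacobi_poly c d M = jacobi_poly c' d' M" using dN0 by simp
  have "(\<forall>j\<in>{1..Suc M}. c j = c' j) \<and> (\<forall>j\<in>{1..M}. d j = d' j)"
  proof (rule jacobi_coefficients_unique[OF RN[unfolded M] RM])
    fix j assume "j \<in> {1..M}"
    hence "j \<in> {1..N}" by (simp add: M)
    hence "b j > 0" "b' j > 0" using b b' by blast+
    thus "d j \<noteq> 0" "d' j \<noteq> 0" by (auto simp: d_def d'_def)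
  qed
  note eq = this
  have c_eq: "c j = c' j" if "j \<in> {1..N}" for j using eq that unfolding M by blast
  have d_eq: "d j = d' j" if "j \<in> {1..N}" for j
  proof (cases "j = N")
    case False
    hence "j \<in> {1..M}" using that by (simp add: M)
    thus ?thesis using eq by blast
  qed (simp add: dN)
  have b_eq: "b j = b' j" if "j \<in> {1..N}" for j
    using d_eq[OF that] bspec[OF b that] bspec[OF b' that]
    by (simp add: d_def d'_def power2_eq_iff_nonneg)
  define P where "P = (\<Prod>k = 1..N. complex_of_real (b k))"
  have "P * bn = \<beta>" using r by (simp add: realizes_def P_def)
  moreover have "P * bn' = \<beta>" using r' b_eq by (simp add: realizes_def P_def)
  ultimately have bn: "bn = bn'" using beta_nonzero by (metis mult_cancel_left mult_zero_left)
  have S: "assoc_poly c d N = assoc_poly c' d' N"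
    by (intro assoc_poly_cong) (use c_eq d_eq in auto)
  have NM: "N - 1 = M" by (simp add: M)
  have shift: "periodic_poly c d z g s N = periodic_poly c d 0 g s N - smult z (jacobi_poly c d N)"
    for z g s by (simp add: periodic_poly_def)
  have "periodic_poly c d a ((cmod bn)\<^sup>2) (2 * Re \<beta>) N = periodic_poly c' d' a' ((cmod bn')\<^sup>2) (2 * Re \<beta>) N"
    using r r' by (simp add: realizes_def d_def d'_def del: prod.cl_ivl_Suc)
  also have "\<dots> = periodic_poly c d a' ((cmod bn)\<^sup>2) (2 * Re \<beta>) N"
    by (simp only: periodic_poly_def RN S dN bn NM RM)
  finally have "smult a (jacobi_poly c d N) = smult a' (jacobi_poly c d N)"
    unfolding shift[of a] shift[of a'] by simp
  hence "coeff (smult a (jacobi_poly c d N)) N = coeff (smult a' (jacobi_poly c d N)) N" by simp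
  hence "a = a'" using jacobi_poly_monic[of c d N] by simp
  show ?thesis unfolding J J' bn \<open>a = a'\<close> by (rule hat_J_cong) (use c_eq b_eq in blast)+
qed

lemma positive_solutions_bij:
  "bij_betw (\<lambda>J. restrict (weight N mu J) {1..N}) (positive_solutions (Suc N) lam mu \<beta>)
     (PiE {1..N} admissible)"
proof (rule bij_betw_imageI)
  have sub: "positive_solutions (Suc N) lam mu \<beta> \<subseteq> solutions (Suc N) lam mu \<beta>"
    by (auto simp: positive_solutions_def)
  show "inj_on (\<lambda>J. restrict (weight N mu J) {1..N}) (positive_solutions (Suc N) lam mu \<beta>)"
  proof (rule inj_onI)
    fix J J' assume J: "J \<in> positive_solutions (Suc N) lam mu \<beta>" "J' \<in> positive_solutions (Suc N) lam mu \<beta>"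
      and e: "restrict (weight N mu J) {1..N} = restrict (weight N mu J') {1..N}"
    show "J = J'"
    proof (rule positive_solution_unique[OF J])
      fix k assume "k \<in> {1..N}"
      thus "weight N mu J k = weight N mu J' k" using fun_cong[OF e, of k] by simp
    qed
  qed
  show "(\<lambda>J. restrict (weight N mu J) {1..N}) ` positive_solutions (Suc N) lam mu \<beta> = PiE {1..N} admissible"
  proof (intro equalityI subsetI)
    fix u assume u: "u \<in> PiE {1..N} admissible"
    obtain J where J: "J \<in> positive_solutions (Suc N) lam mu \<beta>"
      "\<And>k. k \<in> {1..N} \<Longrightarrow> weight N mu J k = u k"
      using positive_solution_exists[OF PiE_mem[OF u]] by blast
    have "restrict (weight N mu J) {1..N} = u"
    proof
      fix k show "restrict (weight N mu J) {1..N} k = u k"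
        using J(2)[of k] PiE_arb[OF u, of k] by (cases "k \<in> {1..N}") auto
    qed
    thus "u \<in> (\<lambda>J. restrict (weight N mu J) {1..N}) ` positive_solutions (Suc N) lam mu \<beta>"
      using J(1) by blast
  next
    fix u assume "u \<in> (\<lambda>J. restrict (weight N mu J) {1..N}) ` positive_solutions (Suc N) lam mu \<beta>"
    then obtain J where J: "J \<in> positive_solutions (Suc N) lam mu \<beta>"
      and u: "u = restrict (weight N mu J) {1..N}" by blast
    have "weight N mu J k \<in> admissible k" if "k \<in> {1..N}" for k
      using weight_admissible[OF _ that] J sub by blast
    thus "u \<in> PiE {1..N} admissible" unfolding u by (simp only: restrict_PiE_iff) blast
  qed
qed

lemma card_admissible:
  "card (admissible k) = (if root_sum k < 2 * cmod \<beta> then 0 else if root_sum k = 2 * cmod \<beta> then 1 else 2)"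
  using card_positive_roots[of "cmod \<beta>" "root_sum k"] beta_nonzero by (simp add: admissible_def)

lemma card_positive_solutions:
  assumes "\<And>k. k \<in> {1..N} \<Longrightarrow> 2 * cmod \<beta> \<le> root_sum k"
  shows "card (positive_solutions (Suc N) lam mu \<beta>)
    = 2 ^ (N - card {k \<in> {1..N}. root_sum k = 2 * cmod \<beta>})"
proof -
  let ?E = "{k \<in> {1..N}. root_sum k = 2 * cmod \<beta>}"
  have "card (positive_solutions (Suc N) lam mu \<beta>) = (\<Prod>k\<in>{1..N}. card (admissible k))"
    using bij_betw_same_card[OF positive_solutions_bij] by (simp add: card_PiE)
  also have "\<dots> = (\<Prod>k\<in>{1..N}. if k \<in> ?E then 1 else 2)"
    using assms by (intro prod.cong) (auto simp: card_admissible not_less)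
  also have "\<dots> = 2 ^ card ({1..N} - ?E)"
    by (subst prod.If_cases) (auto simp: Diff_eq)
  also have "card ({1..N} - ?E) = N - card ?E"
    by (subst card_Diff_subset) auto
  finally show ?thesis .
qed

lemma solutions_nonempty_iff:
  "(\<exists>J\<in>solutions (Suc N) lam mu \<beta>. J $$ (N, N) \<in> \<real>) \<longleftrightarrow> (\<forall>k\<in>{1..N}. 2 * cmod \<beta> \<le> root_sum k)"
proof
  assume "\<exists>J\<in>solutions (Suc N) lam mu \<beta>. J $$ (N, N) \<in> \<real>"
  then obtain J where J: "J \<in> solutions (Suc N) lam mu \<beta>" by blast
  show "\<forall>k\<in>{1..N}. 2 * cmod \<beta> \<le> root_sum k"
  proof
    fix k assume "k \<in> {1..N}"
    hence "admissible k \<noteq> {}" using weight_admissible[OF J] by blast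
    moreover have "finite (admissible k)"
    proof -
      have "admissible k \<subseteq> {u. poly [:(cmod \<beta>)\<^sup>2, - root_sum k, 1:] u = 0}"
        by (auto simp: admissible_def power2_eq_square algebra_simps)
      thus ?thesis by (rule finite_subset) (simp add: poly_roots_finite del: poly_pCons)
    qed
    ultimately show "2 * cmod \<beta> \<le> root_sum k"
      using card_admissible[of k] by (auto split: if_splits)
  qed
next
  assume "\<forall>k\<in>{1..N}. 2 * cmod \<beta> \<le> root_sum k"
  hence "card (positive_solutions (Suc N) lam mu \<beta>) \<noteq> 0" using card_positive_solutions by simp
  then obtain J where "J \<in> positive_solutions (Suc N) lam mu \<beta>" by fastforce
  hence J: "J \<in> solutions (Suc N) lam mu \<beta>" by (simp add: positive_solutions_def)
  then obtain c b a bn where "J = hat_J (Suc N) c b (of_real a) bn" unfolding solutions_eq by blast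
  hence "J $$ (N, N) \<in> \<real>" by (simp add: hat_J_def)
  with J show "\<exists>J\<in>solutions (Suc N) lam mu \<beta>. J $$ (N, N) \<in> \<real>" by blast
qed

end

section \<open>Sign similarity\<close>

lemma sign_similar_sym:
  assumes "A \<in> carrier_mat n n" "(A, B) \<in> sign_similar n"
  shows "(B, A) \<in> sign_similar n"
proof -
  obtain e where e: "\<forall>i<n. e i \<in> {1, -1}" "B = mat n n (\<lambda>(i, j). e i * A $$ (i, j) * e j)"
    using assms(2) by (auto simp: sign_similar_def)
  have sq: "e i * e i = 1" if "i < n" for i using e(1) that by auto
  have "A = mat n n (\<lambda>(i, j). e i * B $$ (i, j) * e j)"
  proof (rule eq_matI)
    fix i j assume ij: "i < dim_row (mat n n (\<lambda>(i, j). e i * B $$ (i, j) * e j))"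
      "j < dim_col (mat n n (\<lambda>(i, j). e i * B $$ (i, j) * e j))"
    hence "mat n n (\<lambda>(i, j). e i * B $$ (i, j) * e j) $$ (i, j) = (e i * e i) * A $$ (i, j) * (e j * e j)"
      by (simp add: e(2) mult_ac)
    thus "A $$ (i, j) = mat n n (\<lambda>(i, j). e i * B $$ (i, j) * e j) $$ (i, j)" using ij sq by simp
  qed (use assms(1) in auto)
  with e(1) show ?thesis unfolding sign_similar_def by blast
qed

lemma sign_similar_trans:
  assumes "(A, B) \<in> sign_similar n" "(B, C) \<in> sign_similar n"
  shows "(A, C) \<in> sign_similar n"
proof -
  obtain e where e: "\<forall>i<n. e i \<in> {1, -1}" "B = mat n n (\<lambda>(i, j). e i * A $$ (i, j) * e j)"
    using assms(1) by (auto simp: sign_similar_def)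
  obtain f where f: "\<forall>i<n. f i \<in> {1, -1}" "C = mat n n (\<lambda>(i, j). f i * B $$ (i, j) * f j)"
    using assms(2) by (auto simp: sign_similar_def)
  have "C = mat n n (\<lambda>(i, j). (e i * f i) * A $$ (i, j) * (e j * f j))"
    unfolding f(2) e(2) by (intro eq_matI) (auto simp: mult_ac)
  moreover have "e i * f i \<in> {1, -1}" if "i < n" for i
    using e(1)[rule_format, OF that] f(1)[rule_format, OF that] by auto
  ultimately show ?thesis unfolding sign_similar_def by (intro CollectI case_prodI exI[of _ "\<lambda>i. e i * f i"]) blast
qed

lemma sign_similar_refl:
  assumes "A \<in> carrier_mat n n"
  shows "(A, A) \<in> sign_similar n"
proof -
  have "A = mat n n (\<lambda>(i, j). 1 * A $$ (i, j) * 1)" using assms by (intro eq_matI) auto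
  thus ?thesis unfolding sign_similar_def by (intro CollectI case_prodI exI[of _ "\<lambda>_. 1"]) blast
qed

lemma sign_similar_class_eq:
  assumes "A \<in> carrier_mat n n" "(A, B) \<in> sign_similar n"
  shows "sign_similar n `` {A} = sign_similar n `` {B}"
  using sign_similar_trans[OF assms(2)] sign_similar_trans[OF sign_similar_sym[OF assms]] by blast

lemma hat_J_carrier: "hat_J n c b a bn \<in> carrier_mat n n"
  by (simp add: hat_J_def)

text \<open>
  Conjugation by a signature matrix stays in the class of matrices, so that it can be studied on the
  parameters.
\<close>

lemma sign_similar_hat_J:
  fixes \<sigma> :: "nat \<Rightarrow> real"
  assumes "\<And>i. i \<le> N \<Longrightarrow> \<sigma> i \<in> {1, -1}"
  shows "mat (Suc N) (Suc N) (\<lambda>(i, j). of_real (\<sigma> i) * hat_J (Suc N) c b a bn $$ (i, j) * of_real (\<sigma> j))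
    = hat_J (Suc N) c (\<lambda>k. \<sigma> (k - 1) * \<sigma> k * b k) a (of_real (\<sigma> 0 * \<sigma> N) * bn)" (is "?L = ?R")
proof (rule eq_matI)
  fix i j assume "i < dim_row ?R" "j < dim_col ?R"
  hence ij: "i < Suc N" "j < Suc N" by (auto simp: hat_J_def)
  have sq: "complex_of_real (\<sigma> i) * x * of_real (\<sigma> i) = x" if "i \<le> N" for i x
    using assms[OF that] by auto
  consider "i = j" | "j = Suc i" | "i = Suc j" | "i \<noteq> j" "j \<noteq> Suc i" "i \<noteq> Suc j" by blast
  thus "?L $$ (i, j) = ?R $$ (i, j)"
  proof cases
    case 1
    thus ?thesis using ij sq[of i] by (simp add: hat_J_def)
  next
    case 2
    thus ?thesis using ij by (simp add: hat_J_def)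
  next
    case 3
    thus ?thesis using ij by (simp add: hat_J_def)
  next
    case 4
    thus ?thesis using ij by (simp add: hat_J_def)
  qed
qed (auto simp: hat_J_def)

context spectral_data
begin

text \<open>
  The polynomials only depend on the \<open>b\<^sub>k\<^sup>2\<close>, on \<open>\<bar>b\<^sub>n\<bar>\<close> and on \<open>\<beta>\<close>; in the product \<open>b\<^sub>1 \<cdots> b\<^sub>n\<close> every sign occurs
  twice.
\<close>

lemma realizes_sign_flip:
  fixes \<sigma> :: "nat \<Rightarrow> real"
  assumes \<sigma>: "\<And>i. i \<le> N \<Longrightarrow> \<sigma> i \<in> {1, -1}" and r: "realizes c b a bn"
  shows "realizes c (\<lambda>k. \<sigma> (k - 1) * \<sigma> k * b k) a (of_real (\<sigma> 0 * \<sigma> N) * bn)"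
proof -
  define b' where "b' = (\<lambda>k. \<sigma> (k - 1) * \<sigma> k * b k)"
  have sq: "\<sigma> i * \<sigma> i = 1" if "i \<le> N" for i using \<sigma>[OF that] by auto
  have b': "(b' j)\<^sup>2 = (b j)\<^sup>2" if "j \<in> {1..N}" for j
  proof -
    have "(b' j)\<^sup>2 = (\<sigma> (j - 1) * \<sigma> (j - 1)) * (\<sigma> j * \<sigma> j) * (b j)\<^sup>2"
      by (simp add: b'_def power2_eq_square mult_ac)
    also have "\<dots> = (b j)\<^sup>2"
    proof -
      have "j - 1 \<le> N" "j \<le> N" using that by auto
      from sq[OF this(1)] sq[OF this(2)] show ?thesis by simp
    qed
    finally show ?thesis .
  qed
  have tele: "(\<Prod>k = 1..m. \<sigma> (k - 1) * \<sigma> k) = \<sigma> 0 * \<sigma> m" if "m \<le> N" for m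
    using that
  proof (induction m)
    case 0
    then show ?case using sq[of 0] by simp
  next
    case (Suc m)
    have "(\<Prod>k = 1..Suc m. \<sigma> (k - 1) * \<sigma> k) = \<sigma> 0 * (\<sigma> m * \<sigma> m) * \<sigma> (Suc m)"
      using Suc by (simp add: mult_ac)
    thus ?case using sq[of m] Suc.prems by simp
  qed
  have J: "jacobi_poly c (\<lambda>j. (b' j)\<^sup>2) k = jacobi_poly c (\<lambda>j. (b j)\<^sup>2) k" if "k \<le> N" for k
    using that by (intro jacobi_poly_cong) (auto simp: b')
  have S: "assoc_poly c (\<lambda>j. (b' j)\<^sup>2) N = assoc_poly c (\<lambda>j. (b j)\<^sup>2) N"
    by (intro assoc_poly_cong) (auto simp: b')
  have norm: "cmod (of_real (\<sigma> 0 * \<sigma> N) * bn) = cmod bn"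
    using \<sigma>[of 0] \<sigma>[of N] by (auto simp: norm_mult)
  have "periodic_poly c (\<lambda>j. (b' j)\<^sup>2) z g s N = periodic_poly c (\<lambda>j. (b j)\<^sup>2) z g s N" for z g s
    using N b'[of N] by (simp add: periodic_poly_def J S)
  moreover have "(\<Prod>k = 1..N. of_real (b' k)) * (of_real (\<sigma> 0 * \<sigma> N) * bn) = \<beta>"
  proof -
    have "(\<Prod>k = 1..N. b' k) = (\<sigma> 0 * \<sigma> N) * (\<Prod>k = 1..N. b k)"
      using tele[of N] by (simp add: b'_def prod.distrib)
    hence e: "(\<Prod>k = 1..N. complex_of_real (b' k))
        = of_real (\<sigma> 0 * \<sigma> N) * (\<Prod>k = 1..N. of_real (b k))"
      by (metis of_real_mult of_real_prod)
    have "complex_of_real (\<sigma> 0 * \<sigma> N) * of_real (\<sigma> 0 * \<sigma> N)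
        = of_real ((\<sigma> 0 * \<sigma> 0) * (\<sigma> N * \<sigma> N))"
      unfolding of_real_mult by (simp only: mult_ac)
    hence s: "complex_of_real (\<sigma> 0 * \<sigma> N) * of_real (\<sigma> 0 * \<sigma> N) = 1"
      using sq[of 0] sq[of N] by simp
    have "(\<Prod>k = 1..N. of_real (b' k)) * (of_real (\<sigma> 0 * \<sigma> N) * bn)
        = (of_real (\<sigma> 0 * \<sigma> N) * of_real (\<sigma> 0 * \<sigma> N)) * ((\<Prod>k = 1..N. of_real (b k)) * bn)"
      unfolding e by (simp only: mult_ac)
    moreover have "(\<Prod>k = 1..N. of_real (b k)) * bn = \<beta>" using r by (simp add: realizes_def)
    ultimately show ?thesis unfolding s by (simp only: mult_1)
  qed
  ultimately show ?thesis
    using r J[of N] unfolding realizes_def b'_def[symmetric] norm by simp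
qed

text \<open>
  The signs are chosen one after the other: \<open>\<sigma>\<^sub>k = \<sigma>\<^sub>k\<^sub>-\<^sub>1 sgn b\<^sub>k\<close>.
\<close>

lemma solution_sign_similar_positive:
  assumes J: "J \<in> solutions (Suc N) lam mu \<beta>"
  obtains J' where "J' \<in> positive_solutions (Suc N) lam mu \<beta>" "(J, J') \<in> sign_similar (Suc N)"
proof -
  obtain c b a bn where J: "J = hat_J (Suc N) c b (of_real a) bn" and r: "realizes c b a bn"
    using J solutions_eq by auto
  define \<sigma> where "\<sigma> i = (\<Prod>k = 1..i. sgn (b k))" for i
  have \<sigma>: "\<sigma> i \<in> {1, -1}" if "i \<le> N" for i
    using that
  proof (induction i)
    case (Suc i)
    have "b (Suc i) \<noteq> 0" using realizes_nonzero(1)[OF r] Suc.prems by simp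
    moreover have "\<sigma> (Suc i) = \<sigma> i * sgn (b (Suc i))" by (simp add: \<sigma>_def)
    ultimately show ?case using Suc by (auto simp: sgn_if)
  qed (simp add: \<sigma>_def)
  define J' where "J' = hat_J (Suc N) c (\<lambda>k. \<sigma> (k - 1) * \<sigma> k * b k) (of_real a) (of_real (\<sigma> 0 * \<sigma> N) * bn)"
  have pos: "\<sigma> (k - 1) * \<sigma> k * b k > 0" if k: "k \<in> {1..N}" for k
  proof -
    obtain i where i: "k = Suc i" using k by (cases k) auto
    have "\<sigma> (k - 1) * \<sigma> k * b k = (\<sigma> i * \<sigma> i) * (sgn (b k) * b k)"
      by (simp add: \<sigma>_def i)
    also have "\<sigma> i * \<sigma> i = 1" using \<sigma>[of i] i k by auto
    also have "sgn (b k) * b k = \<bar>b k\<bar>" by (simp add: abs_sgn mult.commute)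
    finally show ?thesis using realizes_nonzero(1)[OF r k] by simp
  qed
  have flip: "realizes c (\<lambda>k. \<sigma> (k - 1) * \<sigma> k * b k) a (of_real (\<sigma> 0 * \<sigma> N) * bn)"
    by (rule realizes_sign_flip[OF _ r]) (rule \<sigma>)
  have "J' \<in> positive_solutions (Suc N) lam mu \<beta>"
    unfolding positive_solutions_eq J'_def using flip pos
    by (intro CollectI exI[of _ c] exI[of _ "\<lambda>k. \<sigma> (k - 1) * \<sigma> k * b k"] exI[of _ a]
        exI[of _ "of_real (\<sigma> 0 * \<sigma> N) * bn"] conjI ballI refl)
  moreover have "(J, J') \<in> sign_similar (Suc N)"
  proof -
    have "J' = mat (Suc N) (Suc N) (\<lambda>(i, j). of_real (\<sigma> i) * J $$ (i, j) * of_real (\<sigma> j))"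
      unfolding J J'_def by (rule sign_similar_hat_J[symmetric]) (rule \<sigma>)
    moreover have "complex_of_real (\<sigma> i) \<in> {1, -1}" if "i < Suc N" for i
      using \<sigma>[of i] that by auto
    ultimately show ?thesis
      unfolding sign_similar_def by (intro CollectI case_prodI exI[of _ "\<lambda>i. of_real (\<sigma> i)"]) blast
  qed
  ultimately show ?thesis by (rule that)
qed

text \<open>
  If the superdiagonal is positive before and after the conjugation, consecutive signs agree, so the signature
  matrix is the identity or its negative.
\<close>

lemma positive_solutions_sign_similar_eq:
  assumes J: "J \<in> positive_solutions (Suc N) lam mu \<beta>"
    and J': "J' \<in> positive_solutions (Suc N) lam mu \<beta>"
    and sim: "(J, J') \<in> sign_similar (Suc N)"
  shows "J = J'"
proof -
  obtain e where e: "\<forall>i<Suc N. e i \<in> {1, -1}"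
    and J'_eq: "J' = mat (Suc N) (Suc N) (\<lambda>(i, j). e i * J $$ (i, j) * e j)"
    using sim by (auto simp: sign_similar_def)
  obtain c b a bn where J_eq: "J = hat_J (Suc N) c b (of_real a) bn"
    using J unfolding positive_solutions_eq by blast
  have pos: "Re (J $$ (k - 1, k)) > 0" "Re (J' $$ (k - 1, k)) > 0" if "k \<in> {1..N}" for k
    using J J' that by (auto simp: positive_solutions_def)
  have const: "e i = e 0" if "i \<le> N" for i
    using that
  proof (induction i)
    case (Suc i)
    have "J' $$ (i, Suc i) = e i * J $$ (i, Suc i) * e (Suc i)" using Suc.prems by (simp add: J'_eq)
    moreover have "Re (J $$ (i, Suc i)) > 0" "Re (J' $$ (i, Suc i)) > 0"
      using pos[of "Suc i"] Suc.prems by auto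
    moreover have "e i \<in> {1, -1}" "e (Suc i) \<in> {1, -1}" using e Suc.prems by auto
    ultimately have "e (Suc i) = e i" by auto
    with Suc show ?case by simp
  qed simp
  have "e i * x * e j = x" if "i < Suc N" "j < Suc N" for i j x
    using const[of i] const[of j] e that by auto
  thus ?thesis
    using hat_J_carrier[of "Suc N" c b "of_real a" bn] unfolding J'_eq
    by (intro eq_matI) (auto simp: J_eq)
qed

lemma card_solution_classes:
  "card (solutions (Suc N) lam mu \<beta> // sign_similar (Suc N)) = card (positive_solutions (Suc N) lam mu \<beta>)"
proof -
  have carrier: "J \<in> carrier_mat (Suc N) (Suc N)" if "J \<in> solutions (Suc N) lam mu \<beta>" for J
    using that solutions_eq hat_J_carrier by auto
  have sub: "positive_solutions (Suc N) lam mu \<beta> \<subseteq> solutions (Suc N) lam mu \<beta>"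
    by (auto simp: positive_solutions_def)
  have "bij_betw (\<lambda>J. sign_similar (Suc N) `` {J}) (positive_solutions (Suc N) lam mu \<beta>)
      (solutions (Suc N) lam mu \<beta> // sign_similar (Suc N))"
  proof (rule bij_betw_imageI)
    show "inj_on (\<lambda>J. sign_similar (Suc N) `` {J}) (positive_solutions (Suc N) lam mu \<beta>)"
    proof (rule inj_onI)
      fix J J' assume J: "J \<in> positive_solutions (Suc N) lam mu \<beta>" "J' \<in> positive_solutions (Suc N) lam mu \<beta>"
        and e: "sign_similar (Suc N) `` {J} = sign_similar (Suc N) `` {J'}"
      have "(J', J') \<in> sign_similar (Suc N)" using sign_similar_refl carrier sub J(2) by blast
      hence "(J, J') \<in> sign_similar (Suc N)" using e by blast
      thus "J = J'" by (rule positive_solutions_sign_similar_eq[OF J])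
    qed
    show "(\<lambda>J. sign_similar (Suc N) `` {J}) ` positive_solutions (Suc N) lam mu \<beta>
        = solutions (Suc N) lam mu \<beta> // sign_similar (Suc N)"
    proof (intro equalityI subsetI)
      fix X assume "X \<in> solutions (Suc N) lam mu \<beta> // sign_similar (Suc N)"
      then obtain J where J: "J \<in> solutions (Suc N) lam mu \<beta>" and X: "X = sign_similar (Suc N) `` {J}"
        by (auto elim: quotientE)
      obtain J' where J': "J' \<in> positive_solutions (Suc N) lam mu \<beta>" "(J, J') \<in> sign_similar (Suc N)"
        using solution_sign_similar_positive[OF J] by blast
      show "X \<in> (\<lambda>J. sign_similar (Suc N) `` {J}) ` positive_solutions (Suc N) lam mu \<beta>"
        unfolding X sign_similar_class_eq[OF carrier[OF J] J'(2)] using J'(1) by blast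
    next
      fix X assume "X \<in> (\<lambda>J. sign_similar (Suc N) `` {J}) ` positive_solutions (Suc N) lam mu \<beta>"
      then obtain J where J: "J \<in> positive_solutions (Suc N) lam mu \<beta>"
        and X: "X = sign_similar (Suc N) `` {J}" by blast
      show "X \<in> solutions (Suc N) lam mu \<beta> // sign_similar (Suc N)"
        unfolding X by (rule quotientI) (use J sub in blast)
    qed
  qed
  thus ?thesis by (rule bij_betw_same_card[symmetric])
qed

lemma root_sum_condition:
  "(-1) ^ (Suc N - k) * chi (Suc N) lam (mu k) > 0 \<and>
     \<bar>chi (Suc N) lam (mu k) + 2 * Re \<beta>\<bar> \<ge> 2 * cmod \<beta> \<longleftrightarrow> 2 * cmod \<beta> \<le> root_sum k"
  "2 * cmod \<beta> \<le> root_sum k \<Longrightarrow>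
     \<bar>chi (Suc N) lam (mu k) + 2 * Re \<beta>\<bar> = 2 * cmod \<beta> \<longleftrightarrow> root_sum k = 2 * cmod \<beta>"
proof -
  have "(-1 :: real) ^ (Suc N - k) \<in> {1, -1}" by (simp add: minus_one_power_iff)
  note c = strict_sign_condition[OF abs_Re_less_cmod[OF nonreal] this]
  show "(-1) ^ (Suc N - k) * chi (Suc N) lam (mu k) > 0 \<and>
     \<bar>chi (Suc N) lam (mu k) + 2 * Re \<beta>\<bar> \<ge> 2 * cmod \<beta> \<longleftrightarrow> 2 * cmod \<beta> \<le> root_sum k"
    unfolding root_sum_def by (rule c(1))
  show "2 * cmod \<beta> \<le> root_sum k \<Longrightarrow>
     \<bar>chi (Suc N) lam (mu k) + 2 * Re \<beta>\<bar> = 2 * cmod \<beta> \<longleftrightarrow> root_sum k = 2 * cmod \<beta>"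
    unfolding root_sum_def by (rule c(2))
qed

end

section \<open>The inverse problem for periodic Jacobi matrices\<close>

theorem theorem4p3:
  fixes n :: nat and \<beta> :: complex and mu lam :: "nat \<Rightarrow> real"
  assumes "n \<ge> 3"
    and "\<beta> \<notin> \<real>"
    and "strict_mono_on {1..n - 1} mu"
    and "inj_on lam {1..n}"
    and "mu ` {1..n - 1} \<inter> lam ` {1..n} = {}"
  shows
    "((\<exists>J \<in> solutions n lam mu \<beta>. J $$ (n - 1, n - 1) \<in> \<real>) \<longleftrightarrow>
      (\<forall>k \<in> {1..n - 1}. (-1) ^ (n - k) * chi n lam (mu k) > 0 \<and>
         \<bar>chi n lam (mu k) + 2 * Re \<beta>\<bar> \<ge> 2 * cmod \<beta>)) \<and>
     (\<forall>m. (\<forall>k \<in> {1..n - 1}. (-1) ^ (n - k) * chi n lam (mu k) > 0 \<and>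
              \<bar>chi n lam (mu k) + 2 * Re \<beta>\<bar> \<ge> 2 * cmod \<beta>) \<and>
           card {k \<in> {1..n - 1}. \<bar>chi n lam (mu k) + 2 * Re \<beta>\<bar> = 2 * cmod \<beta>} = m \<longrightarrow>
       card (solutions n lam mu \<beta> // sign_similar n) = 2 ^ (n - m - 1) \<and>
       card (positive_solutions n lam mu \<beta>) = 2 ^ (n - m - 1))"
proof -
  define N where "N = n - 1"
  have n: "n = Suc N" using assms(1) by (simp add: N_def)
  interpret spectral_data N lam mu \<beta>
    by unfold_locales (use assms in \<open>auto simp: n\<close>)
  show ?thesis
    unfolding n diff_Suc_1 root_sum_condition(1)
  proof (intro conjI allI impI solutions_nonempty_iff)
    fix m assume H: "(\<forall>k\<in>{1..N}. 2 * cmod \<beta> \<le> root_sum k) \<and>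
      card {k \<in> {1..N}. \<bar>chi (Suc N) lam (mu k) + 2 * Re \<beta>\<bar> = 2 * cmod \<beta>} = m"
    hence "{k \<in> {1..N}. \<bar>chi (Suc N) lam (mu k) + 2 * Re \<beta>\<bar> = 2 * cmod \<beta>}
        = {k \<in> {1..N}. root_sum k = 2 * cmod \<beta>}"
      using root_sum_condition(2) by blast
    with H have m: "card {k \<in> {1..N}. root_sum k = 2 * cmod \<beta>} = m" by simp
    show pos: "card (positive_solutions (Suc N) lam mu \<beta>) = 2 ^ (Suc N - m - 1)"
      using card_positive_solutions H m by simp
    show "card (solutions (Suc N) lam mu \<beta> // sign_similar (Suc N)) = 2 ^ (Suc N - m - 1)"
      unfolding card_solution_classes by (rule pos)
  qed
qed

end
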